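(* 1. When the decision-maker and the worker are aligned ($\delta_F=\delta_W$, $\omega=0$), $V_W(u_W^* )\ge V_W^{\text{no-AI}}$. That is, a worker choosing their own usage does not fall into the augmentation trap. 2. Under discount-rate divergence ($\delta_F>\delta_W$), the decision-maker's policy weakly raises usage relative to the worker's preferred policy, and strictly so at skill levels where both policies are interior. Suppose steady-state output remains below the no-AI level $\bar S$ in the myopic limit $\delta_F\to\infty$. Then there is a threshold $\bar\delta_W>0$ such that for every $\delta_W<\bar\delta_W$, $V_W(u_F^* )<V_W^{\text{no-AI}}$ for all sufficiently large $\delta_F$. Both thresholds (the threshold $\bar\delta_W$ and the level beyond which $\delta_F$ is sufficiently large) depend jointly on all model parameters. 3. Under the worker skill externality ($\omega>0$), the firm's policy ignores the private return $\omega S$ to skill, and the augmentation trap appears for sufficiently large $\omega$.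
   Context: Parameters $\alpha,\beta,\gamma,\kappa,\bar S,\delta_W,\delta_F>0$ and $\omega\ge0$. A worker has skill $S_t\in[0,\bar S]$ with $S_0=\bar S$; AI usage is $u_t\in[0,1]$. Flow productivity is $p(S,u)=(1-u)S+[\alpha+\beta S-\gamma u]u$; skill evolves by $\dot S=\kappa\bar S(1-u)-\kappa S$. The decision-maker (firm) has discount rate $\delta_F$, and its policy $u_F^*$ maximizes $\int_0^\infty e^{-\delta_F t}p(S_t,u_t)\,dt$ over usage in $[0,1]$. The worker has discount rate $\delta_W$ and, in addition to productivity, receives a private flow return $\omega S$ from skill (the worker skill externality). The worker's lifetime welfare under a usage policy $u$ is $$V_W(u)=\int_0^\infty e^{-\delta_W t}\,[p(S_t,u_t)+\omega S_t]\,dt,$$ where $S_t$ is the skill path generated by the policy; the worker's preferred policy $u_W^*$ maximizes $V_W$. $V_W^{\text{no-AI}}$ is the worker's lifetime welfare absent AI, i.e. under $u\equiv0$, which equals $(1+\omega)\bar S/\delta_W$. A deployment is in the augmentation trap if the worker's lifetime welfare under the equilibrium usage policy (the one chosen by the decision-maker) is strictly less than $V_W^{\text{no-AI}}$. A policy is interior at $S$ if $0<u^*(S)<1$. Steady-state output is $p(\hat S,\hat u)$, where $(\hat S,\hat u)$ is the steady state of skill and usage under a policy; the no-AI level of steady-state output is $\bar S$. In the limit $\delta_F\to\infty$ the firm's policy converges to the myopic policy maximizing $p(S,\cdot)$, which when interior is $[\alpha+(\beta-1)S]/(2\gamma)$; the hypothesis in part 2 is that output at the steady state of this myopic policy is below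 $\bar S$.
   Formalization: In part 3 the trap for large ω is claimed only if the firm's policy uses AI at the initial skill, u_F*(S̄)>0; otherwise (e.g. when α ≤ (1−β)S̄) skill stays at S̄, usage is 0 and V_W(u_F* ) = V_W^no-AI for every ω, so the unrestricted claim is false. *)

theory Defs
  imports "HOL-Analysis.Analysis"
begin

record model =
  alpha :: real
  beta :: real
  gamma :: real
  kappa :: real
  Sbar :: real
  deltaW :: real
  deltaF :: real
  omega :: real

definition valid_model :: "model \<Rightarrow> bool" where
  "valid_model M \<longleftrightarrow>
     0 < alpha M \<and> 0 < beta M \<and> 0 < gamma M \<and> 0 < kappa M \<and> 0 < Sbar M \<and>
     0 < deltaW M \<and> 0 < deltaF M \<and> 0 \<le> omega M"

definition productivity :: "model \<Rightarrow> real \<Rightarrow> real \<Rightarrow> real" where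
  "productivity M x v = (1 - v) * x + (alpha M + beta M * x - gamma M * v) * v"

definition skill_drift :: "model \<Rightarrow> real \<Rightarrow> real \<Rightarrow> real" where
  "skill_drift M x v = kappa M * Sbar M * (1 - v) - kappa M * x"

definition usage_process :: "(real \<Rightarrow> real) \<Rightarrow> bool" where
  "usage_process u \<longleftrightarrow> set_borel_measurable lborel {0..} u \<and> (\<forall>t\<ge>0. u t \<in> {0..1})"

text \<open>A usage process is merely measurable in time, so the skill equation for it is stated in
  integral form.\<close>

definition skill_path :: "model \<Rightarrow> real \<Rightarrow> (real \<Rightarrow> real) \<Rightarrow> (real \<Rightarrow> real) \<Rightarrow> bool" where
  "skill_path M S0 u S \<longleftrightarrow>
     S 0 = S0 \<and> continuous_on {0..} S \<and>
     (\<forall>t\<ge>0. ((\<lambda>s. skill_drift M (S s) (u s)) has_integral (S t - S0)) {0..t})"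

text \<open>A policy in feedback form is a function \<open>\<phi>\<close> from skill to usage. Its skill paths are
  classical solutions: the derivative condition at every time, including time 0, determines
  \<open>\<phi>\<close> at each skill level. An almost-everywhere condition would leave \<open>\<phi>\<close> arbitrary at skill
  levels that are passed through at a single instant. For a discontinuous \<open>\<phi>\<close> the path
  need not be unique, hence a relation.\<close>

definition closed_loop :: "model \<Rightarrow> (real \<Rightarrow> real) \<Rightarrow> real \<Rightarrow> (real \<Rightarrow> real) \<Rightarrow> bool" where
  "closed_loop M \<phi> S0 S \<longleftrightarrow>
     S 0 = S0 \<and>
     (\<forall>t\<ge>0. S t \<in> {0..Sbar M} \<and>
       (S has_real_derivative skill_drift M (S t) (\<phi> (S t))) (at t within {0..}))"

definition discounted :: "real \<Rightarrow> (real \<Rightarrow> real) \<Rightarrow> real" where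
  "discounted \<delta> f = (LINT t:{0..}|lborel. exp (- \<delta> * t) * f t)"

definition firm_value :: "model \<Rightarrow> (real \<Rightarrow> real) \<Rightarrow> (real \<Rightarrow> real) \<Rightarrow> real" where
  "firm_value M u S = discounted (deltaF M) (\<lambda>t. productivity M (S t) (u t))"

definition worker_welfare :: "model \<Rightarrow> (real \<Rightarrow> real) \<Rightarrow> (real \<Rightarrow> real) \<Rightarrow> real" where
  "worker_welfare M u S =
     discounted (deltaW M) (\<lambda>t. productivity M (S t) (u t) + omega M * S t)"

text \<open>Competitors are all measurable usage processes, not only those in feedback form.\<close>

definition optimal_policy ::
    "model \<Rightarrow> ((real \<Rightarrow> real) \<Rightarrow> (real \<Rightarrow> real) \<Rightarrow> real) \<Rightarrow> (real \<Rightarrow> real) \<Rightarrow> bool" where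
  "optimal_policy M J \<phi> \<longleftrightarrow>
     (\<forall>x\<in>{0..Sbar M}. \<phi> x \<in> {0..1}) \<and>
     (\<forall>S0\<in>{0..Sbar M}.
        (\<exists>S. closed_loop M \<phi> S0 S) \<and>
        (\<forall>S v T. closed_loop M \<phi> S0 S \<and> usage_process v \<and> skill_path M S0 v T \<longrightarrow>
           J v T \<le> J (\<lambda>t. \<phi> (S t)) S))"

definition firm_policy :: "model \<Rightarrow> (real \<Rightarrow> real) \<Rightarrow> bool" where
  "firm_policy M \<phi> \<longleftrightarrow> optimal_policy M (firm_value M) \<phi>"

definition worker_policy :: "model \<Rightarrow> (real \<Rightarrow> real) \<Rightarrow> bool" where
  "worker_policy M \<phi> \<longleftrightarrow> optimal_policy M (worker_welfare M) \<phi>"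

definition myopic_policy :: "model \<Rightarrow> (real \<Rightarrow> real) \<Rightarrow> bool" where
  "myopic_policy M \<phi> \<longleftrightarrow>
     (\<forall>x\<in>{0..Sbar M}. \<phi> x \<in> {0..1} \<and>
        (\<forall>v\<in>{0..1}. productivity M x v \<le> productivity M x (\<phi> x)))"

definition interior_at :: "(real \<Rightarrow> real) \<Rightarrow> real \<Rightarrow> bool" where
  "interior_at \<phi> x \<longleftrightarrow> 0 < \<phi> x \<and> \<phi> x < 1"

text \<open>The rest point reached from the initial skill \<open>Sbar M\<close>: the drift under \<open>\<phi>\<close> can have
  several zeros (for the myopic policy this happens only if \<open>beta M < 1\<close>).\<close>

definition steady_state :: "model \<Rightarrow> (real \<Rightarrow> real) \<Rightarrow> real \<Rightarrow> bool" where
  "steady_state M \<phi> x \<longleftrightarrow>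
     x \<in> {0..Sbar M} \<and> skill_drift M x (\<phi> x) = 0 \<and>
     (\<exists>S. closed_loop M \<phi> (Sbar M) S \<and> (S \<longlongrightarrow> x) at_top)"

text \<open>Without AI, skill stays at \<open>Sbar M\<close>.\<close>

definition noAI_welfare :: "model \<Rightarrow> real" where
  "noAI_welfare M = worker_welfare M (\<lambda>_. 0) (\<lambda>_. Sbar M)"

lemma skill_path_noAI: "skill_path M (Sbar M) (\<lambda>_. 0) (\<lambda>_. Sbar M)"
  by (simp add: skill_path_def skill_drift_def)

lemma noAI_welfare_eq:
  assumes "valid_model M"
  shows "noAI_welfare M = (1 + omega M) * Sbar M / deltaW M"
proof -
  have d: "0 < deltaW M" using assms by (simp add: valid_model_def)
  have I: "((\<lambda>t. exp (- deltaW M * t)) has_integral exp (- deltaW M * 0) / deltaW M) {0..}"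
    by (rule has_integral_exp_minus_to_infinity[OF d])
  have "(\<lambda>t. exp (- deltaW M * t)) absolutely_integrable_on {0..}"
    by (rule nonnegative_absolutely_integrable_1) (use I in \<open>auto simp only: has_integral_iff exp_ge_zero\<close>)
  then have "(LINT t:{0..}|lebesgue. exp (- deltaW M * t)) = integral {0..} (\<lambda>t. exp (- deltaW M * t))"
    by (rule set_lebesgue_integral_eq_integral(2))
  then have "(LINT t:{0..}|lebesgue. exp (- deltaW M * t)) = 1 / deltaW M"
    using integral_unique[OF I] by simp
  moreover have "(LINT t:{0..}|lebesgue. exp (- deltaW M * t)) =
      (LINT t:{0..}|lborel. exp (- deltaW M * t))"
    unfolding set_lebesgue_integral_def by (intro integral_completion) measurable
  ultimately have *: "(LINT t:{0..}|lborel. exp (- deltaW M * t)) = 1 / deltaW M" by simp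
  have "noAI_welfare M =
      (LINT t:{0..}|lborel. exp (- deltaW M * t) * ((1 + omega M) * Sbar M))"
    unfolding noAI_welfare_def worker_welfare_def discounted_def productivity_def
    by (simp add: algebra_simps)
  also have "\<dots> = (LINT t:{0..}|lborel. exp (- deltaW M * t)) * ((1 + omega M) * Sbar M)"
    by (rule set_integral_mult_left)
  finally show ?thesis using * by simp
qed

text \<open>Here \<open>\<phi>\<close> is the equilibrium usage policy and \<open>S\<close> the skill path it generates.\<close>

definition augmentation_trap :: "model \<Rightarrow> (real \<Rightarrow> real) \<Rightarrow> (real \<Rightarrow> real) \<Rightarrow> bool" where
  "augmentation_trap M \<phi> S \<longleftrightarrow> worker_welfare M (\<lambda>t. \<phi> (S t)) S < noAI_welfare M"

end

theory Submission
  imports Defs "HOL-Real_Asymp.Real_Asymp"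
begin

text \<open>The firm's problem is not concave and may have several optimal policies, so no step relies on
  a smooth value function.

  Maximum principle: since \<open>S\<close> determines \<open>u\<close> through its derivative, moving an optimal control
  towards the pointwise Hamiltonian maximizer \<open>v\<close> changes the payoff by at least
  \<open>2 * \<gamma> * \<epsilon> * \<integral>(v - u)\<^sup>2\<close> up to \<open>O(\<epsilon>\<^sup>2)\<close>, so \<open>u = v\<close>.

  Divergence: if the firm's path lies above the worker's path until they meet again, imitating the
  worker's plan from the firm's higher skill shows that every tail of the productivity difference
  is nonnegative at the rate \<open>\<delta>\<^sub>F\<close>, hence its total is positive at the smaller rate \<open>\<delta>\<^sub>W\<close>, against
  optimality for the worker. Usage \<open>u\<^sub>F < u\<^sub>W\<close>, or equal interior usage (where the costates agree
  but their derivatives do not), would produce such paths.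

  Myopic limit: the costate is \<open>O(1 / \<delta>\<^sub>F)\<close>, so by Gronwall the firm's path follows the myopic path,
  whose discounted output is below that of no AI for a patient worker.

  Externality: the Hamiltonian at time \<open>0\<close> equals \<open>\<delta>\<^sub>F\<close> times the value, which determines the initial
  costate and thereby the whole path when usage starts positive; its skill loss is a fixed
  positive amount, scaled by \<open>\<omega>\<close>.\<close>

section \<open>Calculus on the half-line\<close>

text \<open>A policy is optimal from every starting skill and its paths are differentiable at time
  \<open>0\<close> too, so \<open>\<phi> x\<close> can be read off the initial direction of an
  optimal path from \<open>x\<close>. Pointwise comparisons of policies thus become comparisons of
  paths near time \<open>0\<close>.

  An optimal feedback is not known to be continuous, nor is the control it generates. The maximum
  principle repairs this by expressing the control through two continuous functions, skill and
  costate. Its bounds on the costate matter as much: the positive lower bound forces strict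
  divergence where both policies are interior, and the upper bound of order
  \<open>1 / (d + \<kappa>)\<close> drives the myopic limit.

  In both threshold claims the firm's policy is quantified inside the limit, so one threshold has to
  serve all optimal policies. In the myopic limit the tracking error has a bound that depends on the
  parameters only; for the externality, all optimal policies with positive usage at full skill
  generate the same path from there.\<close>

lemma at_within_atLeast_interior:
  fixes t :: real assumes "0 < t" shows "at t within {0..} = at t"
  using assms by (intro at_within_interior) simp

lemma ray_deriv_imp_continuous:
  assumes "\<And>t. t \<ge> 0 \<Longrightarrow> (F has_real_derivative f t) (at t within {0..})"
  shows "continuous_on {0..} F"
  using assms DERIV_continuous_on[of "{0..}" F f] by auto

lemma ray_mono:
  assumes F: "\<And>t. t \<ge> 0 \<Longrightarrow> (F has_real_derivative f t) (at t within {0..})"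
    and "0 \<le> a" "a \<le> b" and f: "\<And>t. a < t \<Longrightarrow> t < b \<Longrightarrow> 0 \<le> f t"
  shows "F a \<le> (F b :: real)"
proof (rule DERIV_nonneg_imp_increasing_open[OF \<open>a \<le> b\<close>])
  show "\<exists>y. (F has_real_derivative y) (at t) \<and> 0 \<le> y" if "a < t" "t < b" for t
    using F[of t] f[of t] that \<open>0 \<le> a\<close> at_within_atLeast_interior[of t] by auto
  show "continuous_on {a..b} F"
    by (rule continuous_on_subset[OF ray_deriv_imp_continuous[OF F]]) (use \<open>0 \<le> a\<close> in auto)
qed

lemma ray_strict_mono:
  assumes F: "\<And>t. t \<ge> 0 \<Longrightarrow> (F has_real_derivative f t) (at t within {0..})"
    and "0 \<le> a" "a < b" and f: "\<And>t. a < t \<Longrightarrow> t < b \<Longrightarrow> 0 < f t"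
  shows "F a < (F b :: real)"
proof (rule DERIV_pos_imp_increasing_open[OF \<open>a < b\<close>])
  show "\<exists>y. (F has_real_derivative y) (at t) \<and> 0 < y" if "a < t" "t < b" for t
    using F[of t] f[of t] that \<open>0 \<le> a\<close> at_within_atLeast_interior[of t] by auto
  show "continuous_on {a..b} F"
    by (rule continuous_on_subset[OF ray_deriv_imp_continuous[OF F]]) (use \<open>0 \<le> a\<close> in auto)
qed

lemma ray_FTC:
  assumes F: "\<And>t. t \<ge> 0 \<Longrightarrow> (F has_real_derivative f t) (at t within {0..})"
    and "0 \<le> a" "a \<le> b"
  shows "(f has_integral (F b - F a)) {a..b}"
proof (rule fundamental_theorem_of_calculus[OF \<open>a \<le> b\<close>])
  fix t assume "t \<in> {a..b}"
  then show "(F has_vector_derivative f t) (at t within {a..b})"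
    using F[of t] \<open>0 \<le> a\<close> has_vector_derivative_within_subset[of F "f t" t "{0..}" "{a..b}"]
    by (auto simp: has_real_derivative_iff_has_vector_derivative)
qed

lemma ray_antiderivative:
  assumes g: "continuous_on {0..} (g :: real \<Rightarrow> real)"
  obtains F where "F 0 = 0" "\<And>t. t \<ge> 0 \<Longrightarrow> (F has_real_derivative g t) (at t within {0..})"
proof (rule that[of "\<lambda>t. integral {0..t} g"])
  let ?F = "\<lambda>t. integral {0..t} g"
  show "?F 0 = 0" by simp
  fix t :: real assume t: "t \<ge> 0"
  have "(?F has_real_derivative g t) (at t within {0..t+1})"
    by (rule integral_has_real_derivative) (use t continuous_on_subset[OF g] in auto)
  moreover have "at t within {0..t+1} = at t within {0..}"
    by (rule at_within_nhd[where S="{t-1<..<t+1}"]) auto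
  ultimately show "(?F has_real_derivative g t) (at t within {0..})" by simp
qed

lemma ray_deriv_unique:
  assumes "(F has_real_derivative a) (at t within {0..})" "(F has_real_derivative b) (at t within {0..})" "t \<ge> 0"
  shows "a = b"
proof (cases "t = 0")
  case True
  then show ?thesis
    using assms has_field_derivative_unique[of F a t "{0..}" b] by (simp add: at_within_Ici_at_right)
next
  case False
  then show ?thesis
    using assms at_within_atLeast_interior[of t] by (auto intro: DERIV_unique)
qed

text \<open>Shaped for squared distances: the forcing is a square because
  \<open>2 * x * e \<le> x\<^sup>2 + e\<^sup>2\<close> splits the cross term caused by a
  perturbation of size \<open>e\<close>, and \<open>K \<ge> 1\<close> removes a factor
  \<open>1 / K\<close>. With \<open>e = 0\<close> it yields uniqueness.\<close>

lemma gronwall_square: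
  assumes X: "\<And>t. t \<ge> 0 \<Longrightarrow> (X has_real_derivative X' t) (at t within {0..})"
    and le: "\<And>t. t \<ge> 0 \<Longrightarrow> X' t \<le> K * X t + e^2" and "X 0 = 0" "K \<ge> 1" "t \<ge> 0"
  shows "X t \<le> e^2 * exp (K * t)"
proof -
  let ?E = "\<lambda>t. - (X t * exp (- K * t) + e^2 * exp (- K * t) / K)"
  have "(?E has_real_derivative - ((X' t - K * X t - e^2) * exp (- K * t))) (at t within {0..})" if "t \<ge> 0" for t
    using that \<open>K \<ge> 1\<close>
    by (auto intro!: derivative_eq_intros X simp: field_simps)
  then have "?E 0 \<le> ?E t"
    by (rule ray_mono) (use le \<open>t \<ge> 0\<close> in \<open>auto intro!: mult_nonpos_nonneg simp: diff_diff_eq\<close>)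
  then have "X t * exp (- K * t) \<le> e^2 / K - e^2 * exp (- K * t) / K"
    using \<open>X 0 = 0\<close> by simp
  also have "\<dots> \<le> e^2 / 1"
    using \<open>K \<ge> 1\<close> by (smt (verit) divide_nonneg_pos exp_ge_zero frac_le mult_nonneg_nonneg zero_le_power2)
  finally have "X t * exp (- K * t) * exp (K * t) \<le> e^2 * exp (K * t)" by (simp add: mult_right_mono)
  then show ?thesis by (simp add: mult.assoc exp_minus)
qed

text \<open>The right initial value is trapped between an increasing and a decreasing function of time.\<close>

lemma bounded_adjoint_solution:
  fixes Q :: "real \<Rightarrow> real"
  assumes Q: "continuous_on {0..} Q" and bd: "\<And>t. t \<ge> 0 \<Longrightarrow> \<bar>Q t\<bar> \<le> C" and "r > 0"
  obtains z where "\<And>t. t \<ge> 0 \<Longrightarrow> (z has_real_derivative r * z t - Q t) (at t within {0..})"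
    "\<And>t. t \<ge> 0 \<Longrightarrow> \<bar>z t\<bar> \<le> C / r"
proof -
  have "continuous_on {0..} (\<lambda>t. exp (- r * t) * Q t)" by (intro continuous_intros Q)
  then obtain I where I: "\<And>t. t \<ge> 0 \<Longrightarrow> (I has_real_derivative exp (- r * t) * Q t) (at t within {0..})"
    by (rule ray_antiderivative) blast
  \<comment> \<open>The candidate \<open>exp (r * t) * (z0 - I t)\<close> stays within
    \<open>C / r\<close> exactly when \<open>?lo t \<le> z0 \<le> - ?hi t\<close>, so any number
    between all these barriers is a suitable initial value. The upper barrier is negated so that the
    same monotonicity lemma serves both.\<close>
  let ?lo = "\<lambda>t. I t - C / r * exp (- r * t)" and ?hi = "\<lambda>t. - (I t + C / r * exp (- r * t))"
  have lo': "(?lo has_real_derivative exp (- r * t) * (Q t + C)) (at t within {0..})" if "t \<ge> 0" for t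
    using that \<open>r > 0\<close> by (auto intro!: derivative_eq_intros I simp: field_simps)
  have hi': "(?hi has_real_derivative exp (- r * t) * (C - Q t)) (at t within {0..})" if "t \<ge> 0" for t
    using that \<open>r > 0\<close> by (auto intro!: derivative_eq_intros I simp: field_simps)
  have lo: "?lo s \<le> ?lo t" and hi: "?hi s \<le> ?hi t" if "0 \<le> s" "s \<le> t" for s t
    using ray_mono[OF lo' that] ray_mono[OF hi' that] bd that by (smt (verit) abs_le_D1 abs_le_D2 exp_ge_zero mult_nonneg_nonneg)+
  have C: "C \<ge> 0" using bd[of 0] by auto
  have cross: "?lo s \<le> - ?hi t" if "0 \<le> s" "0 \<le> t" for s t
  proof -
    have "0 \<le> C / r * exp (- r * max s t)" using C \<open>r > 0\<close> by simp
    then show ?thesis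
      using lo[of s "max s t"] hi[of t "max s t"] that by linarith
  qed
  define z0 where "z0 = Sup (?lo ` {0..})"
  have bdd: "bdd_above (?lo ` {0..})" using cross[of _ 0] by (intro bdd_aboveI2[where M="- ?hi 0"]) auto
  have up: "?lo t \<le> z0" if "t \<ge> 0" for t unfolding z0_def by (rule cSup_upper[OF _ bdd]) (use that in auto)
  have dn: "z0 \<le> - ?hi t" if "t \<ge> 0" for t
    unfolding z0_def by (rule cSup_least) (use that cross in auto)
  show ?thesis
  proof (rule that[of "\<lambda>t. exp (r * t) * (z0 - I t)"])
    let ?z = "\<lambda>t. exp (r * t) * (z0 - I t)"
    show "(?z has_real_derivative r * ?z t - Q t) (at t within {0..})" if "t \<ge> 0" for t
      using that by (auto intro!: derivative_eq_intros I simp: algebra_simps exp_minus)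
    show "\<bar>?z t\<bar> \<le> C / r" if "t \<ge> 0" for t
    proof -
      have "\<bar>z0 - I t\<bar> \<le> C / r * exp (- r * t)" using up[OF that] dn[OF that] by linarith
      then have "exp (r * t) * \<bar>z0 - I t\<bar> \<le> exp (r * t) * (C / r * exp (- r * t))" by (rule mult_left_mono) simp
      also have "\<dots> = C / r" by (simp add: exp_minus)
      finally show ?thesis by (simp add: abs_mult)
    qed
  qed
qed

text \<open>The equation is unstable forward in time: an excess over \<open>Q / r\<close> would grow
  at least like \<open>exp (r * t)\<close>, which a bounded solution cannot do. This turns bounds on
  the forcing into pointwise bounds on the costate.\<close>

lemma bounded_adjoint_le:
  assumes z: "\<And>t. t \<ge> 0 \<Longrightarrow> (z has_real_derivative r * z t - q t) (at t within {0..})"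
    and bd: "\<And>t. t \<ge> 0 \<Longrightarrow> \<bar>z t\<bar> \<le> B" and q: "\<And>t. t \<ge> 0 \<Longrightarrow> q t \<le> Q" and "r > 0" "t \<ge> 0"
  shows "z t \<le> Q / r"
proof (rule ccontr)
  let ?F = "\<lambda>t. exp (- r * t) * (z t - Q / r)"
  assume "\<not> ?thesis"
  then have pos: "?F t > 0" by simp
  have F': "(?F has_real_derivative exp (- r * t) * (Q - q t)) (at t within {0..})" if "t \<ge> 0" for t
    using that \<open>r > 0\<close> by (auto intro!: derivative_eq_intros z simp: field_simps)
  have "?F t \<le> ?F s" if "t \<le> s" for s
    by (rule ray_mono[OF F' \<open>t \<ge> 0\<close> that]) (use q \<open>t \<ge> 0\<close> in auto)
  moreover have "?F s \<le> (B + \<bar>Q / r\<bar>) * exp (- r * s)" if "t \<le> s" for s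
  proof -
    have "z s - Q / r \<le> B + \<bar>Q / r\<bar>" using bd[of s] that \<open>t \<ge> 0\<close> by linarith
    then show ?thesis by (simp add: mult.commute)
  qed
  ultimately have "?F t \<le> (B + \<bar>Q / r\<bar>) * exp (- r * s)" if "t \<le> s" for s
    using that order_trans by blast
  then have "\<forall>\<^sub>F s in at_top. ?F t \<le> (B + \<bar>Q / r\<bar>) * exp (- r * s)"
    using eventually_ge_at_top[of t] by (rule eventually_mono[rotated])
  moreover have lim: "((\<lambda>s. (B + \<bar>Q / r\<bar>) * exp (- r * s)) \<longlongrightarrow> 0) at_top"
    using \<open>r > 0\<close> by real_asymp
  ultimately have "?F t \<le> 0"
    by (intro tendsto_lowerbound[OF lim]) auto
  with pos show False by simp
qed

section \<open>Discounted integrals of bounded flows\<close>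

text \<open>Measurability is asked for on \<open>{0..}\<close> only, since nothing is known about
  controls at negative times. Boundedness makes the discounted integral converge at every positive
  rate, so firm and worker can be treated alike.\<close>

definition flow :: "(real \<Rightarrow> real) \<Rightarrow> bool" where
  "flow f \<longleftrightarrow> f \<in> borel_measurable (restrict_space lborel {0..}) \<and> (\<exists>C. \<forall>t\<ge>0. \<bar>f t\<bar> \<le> C)"

lemma flow_continuous:
  assumes "continuous_on {0..} f" "\<And>t. t \<ge> 0 \<Longrightarrow> \<bar>f t\<bar> \<le> C"
  shows "flow f"
proof -
  have "f \<in> borel_measurable (restrict_space borel {0..})"
    by (rule borel_measurable_continuous_on_restrict[OF assms(1)])
  then have "f \<in> borel_measurable (restrict_space lborel {0..})"
    by (subst borel_measurable_restrict_space_iff) (auto simp: borel_measurable_restrict_space_iff)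
  then show ?thesis using assms(2) by (auto simp: flow_def)
qed

lemma flow_const [intro, simp]: "flow (\<lambda>_. c)"
  by (rule flow_continuous[of _ "\<bar>c\<bar>"]) auto

lemma flow_add [intro, simp]: "flow f \<Longrightarrow> flow g \<Longrightarrow> flow (\<lambda>t. f t + g t)"
  unfolding flow_def
proof (elim conjE exE, intro conjI)
  fix C D assume "\<forall>t\<ge>0. \<bar>f t\<bar> \<le> C" "\<forall>t\<ge>0. \<bar>g t\<bar> \<le> D"
  then show "\<exists>C. \<forall>t\<ge>0. \<bar>f t + g t\<bar> \<le> C" by (intro exI[of _ "C + D"]) (smt (verit))
qed auto

lemma flow_mult [intro, simp]: "flow f \<Longrightarrow> flow g \<Longrightarrow> flow (\<lambda>t. f t * g t)"
  unfolding flow_def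
proof (elim conjE exE, intro conjI)
  fix C D assume "\<forall>t\<ge>0. \<bar>f t\<bar> \<le> C" "\<forall>t\<ge>0. \<bar>g t\<bar> \<le> D"
  then show "\<exists>C. \<forall>t\<ge>0. \<bar>f t * g t\<bar> \<le> C"
    by (intro exI[of _ "C * D"]) (auto simp: abs_mult intro!: mult_mono intro: order_trans[OF abs_ge_zero])
qed auto

lemma flow_minus [intro, simp]: "flow f \<Longrightarrow> flow (\<lambda>t. - f t)"
  using flow_mult[OF flow_const[of "-1"], of f] by simp

lemma flow_diff [intro, simp]: "flow f \<Longrightarrow> flow g \<Longrightarrow> flow (\<lambda>t. f t - g t)"
  using flow_add[OF _ flow_minus[of g], of f] by simp

lemma flow_power [intro, simp]: "flow f \<Longrightarrow> flow (\<lambda>t. f t ^ n)"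
  by (induction n) auto

lemma flow_switch [intro, simp]: "flow f \<Longrightarrow> flow g \<Longrightarrow> flow (\<lambda>t. if t < a then f t else g t)"
  unfolding flow_def
proof (elim conjE exE, intro conjI)
  assume [measurable]: "f \<in> borel_measurable (restrict_space lborel {0..})" "g \<in> borel_measurable (restrict_space lborel {0..})"
  have [measurable]: "(\<lambda>x. x) \<in> borel_measurable (restrict_space lborel {0..})"
    by (rule measurable_restrict_space1) auto
  show "(\<lambda>t. if t < a then f t else g t) \<in> borel_measurable (restrict_space lborel {0..})"
    by measurable
  fix C D assume "\<forall>t\<ge>0. \<bar>f t\<bar> \<le> C" "\<forall>t\<ge>0. \<bar>g t\<bar> \<le> D"
  then show "\<exists>C. \<forall>t\<ge>0. \<bar>if t < a then f t else g t\<bar> \<le> C"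
    by (intro exI[of _ "max C D"]) auto
qed

lemma flow_iff_set_measurable:
  "flow f \<longleftrightarrow> set_borel_measurable lborel {0..} f \<and> (\<exists>C. \<forall>t\<ge>0. \<bar>f t\<bar> \<le> C)"
  unfolding flow_def set_borel_measurable_def by (subst borel_measurable_restrict_space_iff) auto

lemma set_integrable_exp_minus:
  fixes d :: real
  assumes "d > 0" shows "set_integrable lborel {0..} (\<lambda>t. exp (- d * t))"
proof -
  have I: "((\<lambda>t. exp (- d * t)) has_integral exp (- d * 0) / d) {0..}"
    by (rule has_integral_exp_minus_to_infinity[OF assms])
  have "(\<lambda>t. exp (- d * t)) absolutely_integrable_on {0..}"
    by (rule nonnegative_absolutely_integrable_1) (use I in \<open>auto simp only: has_integral_iff exp_ge_zero\<close>)
  then show ?thesis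
    unfolding set_integrable_def
    by (subst (asm) integrable_completion) measurable
qed

lemma discounted_integrable:
  assumes "flow f" "d > 0"
  shows "set_integrable lborel {0..} (\<lambda>t. exp (- d * t) * f t)"
proof -
  obtain C where C: "\<And>t. t \<ge> 0 \<Longrightarrow> \<bar>f t\<bar> \<le> C" using assms by (auto simp: flow_def)
  have m: "(\<lambda>t. indicat_real {0..} t * f t) \<in> borel_measurable lborel"
    using assms(1) by (simp add: flow_iff_set_measurable set_borel_measurable_def)
  have "set_integrable lborel {0..} (\<lambda>t. C * exp (- d * t))"
    using set_integrable_exp_minus[OF assms(2)] by simp
  then show ?thesis
  proof (rule set_integrable_bound)
    have "(\<lambda>t. exp (- d * t) * (indicat_real {0..} t * f t)) \<in> borel_measurable lborel"
      using m by measurable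
    then show "set_borel_measurable lborel {0..} (\<lambda>t. exp (- d * t) * f t)"
      unfolding set_borel_measurable_def by (simp add: mult.left_commute)
    show "AE x in lborel. x \<in> {0..} \<longrightarrow> norm (exp (- d * x) * f x) \<le> norm (C * exp (- d * x))"
      using C by (auto simp: abs_mult intro: order_trans[OF _ abs_ge_self])
  qed
qed

context
  fixes d :: real assumes d: "d > 0"
begin

lemma discounted_add: "flow f \<Longrightarrow> flow g \<Longrightarrow> discounted d (\<lambda>t. f t + g t) = discounted d f + discounted d g"
  unfolding discounted_def using set_integral_add(2)[OF discounted_integrable[OF _ d] discounted_integrable[OF _ d], of f g]
  by (simp add: distrib_left)

lemma discounted_diff: "flow f \<Longrightarrow> flow g \<Longrightarrow> discounted d (\<lambda>t. f t - g t) = discounted d f - discounted d g"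
  unfolding discounted_def using set_integral_diff(2)[OF discounted_integrable[OF _ d] discounted_integrable[OF _ d], of f g]
  by (simp add: right_diff_distrib)

lemma discounted_mono: "flow f \<Longrightarrow> flow g \<Longrightarrow> (\<And>t. t \<ge> 0 \<Longrightarrow> f t \<le> g t) \<Longrightarrow> discounted d f \<le> discounted d g"
  unfolding discounted_def
  by (rule set_integral_mono[OF discounted_integrable[OF _ d] discounted_integrable[OF _ d]]) auto

end

lemma discounted_cmult: "discounted d (\<lambda>t. c * f t) = c * discounted d f"
proof -
  have "(\<lambda>t. exp (- d * t) * (c * f t)) = (\<lambda>t. c * (exp (- d * t) * f t))" by auto
  then show ?thesis unfolding discounted_def by simp
qed

lemma discounted_cong: "(\<And>t. t \<ge> 0 \<Longrightarrow> f t = g t) \<Longrightarrow> discounted d f = discounted d g"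
  unfolding discounted_def by (rule set_lebesgue_integral_cong) auto

text \<open>Serves as integration by parts on the half-line, with \<open>F\<close> a discounted
  product or Hamiltonian. \<open>f\<close> is only bounded and measurable because controls enter the
  derivatives without being known to be continuous.\<close>

lemma discounted_derivative:
  assumes F: "\<And>t. t \<ge> 0 \<Longrightarrow> (F has_real_derivative exp (- d * t) * f t) (at t within {0..})"
    and "flow f" "d > 0" and lim: "(F \<longlongrightarrow> 0) at_top"
  shows "discounted d f = - F 0"
proof -
  let ?g = "\<lambda>t. exp (- d * t) * f t"
  have int: "set_integrable lborel {0..} ?g" by (rule discounted_integrable) fact+
  then have "((\<lambda>b. LINT t:{0..b}|lborel. ?g t) \<longlongrightarrow> discounted d f) at_top"
    unfolding discounted_def by (intro tendsto_set_lebesgue_integral_at_top) auto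
  moreover have "\<forall>\<^sub>F b in at_top. (LINT t:{0..b}|lborel. ?g t) = F b - F 0"
    using eventually_ge_at_top[of 0]
  proof eventually_elim
    case (elim b)
    have "set_integrable lborel {0..b} ?g" by (rule set_integrable_subset[OF int]) auto
    then show ?case
      using ray_FTC[OF F, of 0 b] elim by (simp add: set_borel_integral_eq_integral(2) integral_unique)
  qed
  ultimately have "((\<lambda>b. F b - F 0) \<longlongrightarrow> discounted d f) at_top"
    by (rule Lim_transform_eventually)
  moreover have "((\<lambda>b. F b - F 0) \<longlongrightarrow> 0 - F 0) at_top" by (intro tendsto_intros lim)
  ultimately show ?thesis using tendsto_unique[OF trivial_limit_at_top_linorder] by fastforce
qed

lemma discounted_const: "d > 0 \<Longrightarrow> discounted d (\<lambda>_. c) = c / d"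
proof -
  assume d: "d > 0"
  have "discounted d (\<lambda>_. c) = - (- c / d * exp (- d * 0))"
    by (rule discounted_derivative[where F="\<lambda>t. - c / d * exp (- d * t)"])
       (use d in \<open>auto intro!: derivative_eq_intros\<close>, real_asymp)
  then show ?thesis by simp
qed

section \<open>Positivity of discounted integrals, and change of the discount rate\<close>

lemma discounted_nonneg:
  "flow f \<Longrightarrow> d > 0 \<Longrightarrow> (\<And>t. t \<ge> 0 \<Longrightarrow> 0 \<le> f t) \<Longrightarrow> 0 \<le> discounted d f"
  using discounted_mono[of d "\<lambda>_. 0" f] discounted_const[of d 0] by simp

lemma integral_pos_of_pos_on_interval:
  fixes f :: "real \<Rightarrow> real"
  assumes int: "integrable lborel f" and nn: "\<And>t. 0 \<le> f t"
    and "a < b" and pos: "\<And>t. a < t \<Longrightarrow> t < b \<Longrightarrow> 0 < f t"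
  shows "0 < (\<integral>t. f t \<partial>lborel)"
proof -
  have "(\<integral>t. f t \<partial>lborel) \<noteq> 0"
  proof
    assume "(\<integral>t. f t \<partial>lborel) = 0"
    then have "AE t in lborel. f t = 0"
      using integral_nonneg_eq_0_iff_AE[OF int] nn by auto
    then have "AE t in lborel. t \<notin> {a<..<b}"
      by (rule eventually_mono) (use pos in force)
    then have "emeasure lborel {a<..<b} = 0"
      by (subst (asm) AE_iff_measurable[of "{a<..<b}"]) auto
    then show False using \<open>a < b\<close> by simp
  qed
  then show ?thesis using integral_nonneg_AE[of f lborel] nn by (simp add: less_le)
qed

lemma discounted_pos:
  assumes f: "flow f" "d > 0" "\<And>t. t \<ge> 0 \<Longrightarrow> 0 \<le> f t" and ab: "0 \<le> a" "a < b"
    and pos: "\<And>t. a < t \<Longrightarrow> t < b \<Longrightarrow> 0 < f t"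
  shows "0 < discounted d f"
  unfolding discounted_def set_lebesgue_integral_def
proof (rule integral_pos_of_pos_on_interval[OF _ _ \<open>a < b\<close>])
  show "integrable lborel (\<lambda>t. indicat_real {0..} t *\<^sub>R (exp (- d * t) * f t))"
    using discounted_integrable[OF f(1,2)] by (simp add: set_integrable_def)
  show "0 \<le> indicat_real {0..} t *\<^sub>R (exp (- d * t) * f t)" for t
    using f(3)[of t] by (simp add: indicator_def)
  show "0 < indicat_real {0..} t *\<^sub>R (exp (- d * t) * f t)" if "a < t" "t < b" for t
    using pos[OF that] that ab by (simp add: indicator_def)
qed

lemma continuous_nonneg_discounted_eq_0:
  assumes "flow f" "d > 0" and nn: "\<And>t. t \<ge> 0 \<Longrightarrow> 0 \<le> f t" and cont: "continuous_on {0..} f"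
    and le: "discounted d f \<le> 0" and "t \<ge> 0"
  shows "f t = 0"
proof (rule ccontr)
  assume "f t \<noteq> 0"
  with nn[OF \<open>t \<ge> 0\<close>] have "f t > 0" by simp
  with cont \<open>t \<ge> 0\<close> have "\<forall>\<^sub>F s in at t within {0..}. f s > 0"
    by (intro order_tendstoD) (auto simp: continuous_on_def)
  then obtain e where e: "e > 0" "\<And>s. s \<ge> 0 \<Longrightarrow> s \<noteq> t \<Longrightarrow> dist s t < e \<Longrightarrow> f s > 0"
    by (auto simp: eventually_at)
  have "0 < discounted d f"
    by (rule discounted_pos[of f d t "t + e"]) (use assms e in \<open>auto simp: dist_real_def\<close>)
  with le show False by simp
qed

text \<open>Write \<open>exp ((\<delta> - d) * s) - 1\<close> as an integral over \<open>{0..s}\<close> and exchange the order of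
  integration: the value at rate \<open>d\<close> is a positive combination of the tails at rate \<open>\<delta>\<close>.\<close>

lemma discounted_pos_of_tails:
  assumes f: "flow f" and d: "0 < d" "d < \<delta>"
    and tails: "\<And>t. t \<ge> 0 \<Longrightarrow> 0 \<le> discounted \<delta> (\<lambda>s. if s < t then 0 else f s)"
    and e: "0 < e" "\<And>t. 0 < t \<Longrightarrow> t < e \<Longrightarrow> 0 < discounted \<delta> (\<lambda>s. if s < t then 0 else f s)"
  shows "0 < discounted d f"
proof -
  define \<rho> where "\<rho> = \<delta> - d"
  have \<rho>: "\<rho> > 0" using d by (simp add: \<rho>_def)
  define h where "h = (\<lambda>s. indicat_real {0..} s * (exp (- \<delta> * s) * f s))"
  obtain C where C: "\<And>t. t \<ge> 0 \<Longrightarrow> \<bar>f t\<bar> \<le> C" using f by (auto simp: flow_def)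
  have hm [measurable]: "h \<in> borel_measurable borel"
    using discounted_integrable[OF f, of \<delta>] d unfolding h_def set_integrable_def
    by (auto dest!: borel_measurable_integrable)
  \<comment> \<open>The kernel \<open>k s\<close> has integral \<open>exp (\<rho> * s) - 1\<close>;
    multiplied by \<open>h s\<close> this is the integrand at rate \<open>d\<close> minus the one at
    rate \<open>\<delta>\<close>.\<close>
  define k where "k = (\<lambda>s t. indicat_real {0..s} t * (\<rho> * exp (\<rho> * t)))"
  define F where "F = (\<lambda>s t. h s * k s t)"
  have km: "case_prod k \<in> borel_measurable (lborel \<Otimes>\<^sub>M lborel)"
  proof -
    have "case_prod k = (\<lambda>x. (if 0 \<le> snd x \<and> snd x \<le> fst x then \<rho> * exp (\<rho> * snd x) else 0))"
      by (auto simp: k_def fun_eq_iff)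
    also have "\<dots> \<in> borel_measurable (lborel \<Otimes>\<^sub>M lborel)"
      by measurable
    finally show ?thesis .
  qed
  have k: "integrable lborel (k s)" "(\<integral>t. k s t \<partial>lborel) = exp (\<rho> * s) - 1" if "s \<ge> 0" for s
  proof -
    have i: "set_integrable lborel {0..s} (\<lambda>t. \<rho> * exp (\<rho> * t))"
      by (rule borel_integrable_atLeastAtMost') (intro continuous_intros)
    then show "integrable lborel (k s)" by (simp add: k_def set_integrable_def)
    have "((\<lambda>t. \<rho> * exp (\<rho> * t)) has_integral (exp (\<rho> * s) - exp (\<rho> * 0))) {0..s}"
      by (rule ray_FTC[of "\<lambda>t. exp (\<rho> * t)"]) (use that in \<open>auto intro!: derivative_eq_intros\<close>)
    then show "(\<integral>t. k s t \<partial>lborel) = exp (\<rho> * s) - 1"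
      using set_borel_integral_eq_integral(2)[OF i] unfolding k_def set_lebesgue_integral_def real_scaleR_def
      by (simp only: integral_unique) simp
  qed
  have hk: "h s * (exp (\<rho> * s) - 1) = indicat_real {0..} s * (exp (- d * s) * f s) - h s" for s
    by (auto simp: h_def \<rho>_def algebra_simps indicator_def simp flip: exp_add)
  have Fint: "(\<integral>t. F s t \<partial>lborel) = indicat_real {0..} s * (exp (- d * s) * f s) - h s" for s
  proof (cases "s \<ge> 0")
    case True then show ?thesis using k[OF True] hk[of s] by (simp add: F_def)
  qed (simp add: F_def h_def)
  have id: "integrable lborel (\<lambda>s. indicat_real {0..} s * (exp (- d * s) * f s))" "integrable lborel h"
    using discounted_integrable[OF f, of d] discounted_integrable[OF f, of \<delta>] d
    by (simp_all add: set_integrable_def h_def)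
  have FI: "integrable (lborel \<Otimes>\<^sub>M lborel) (case_prod F)"
  proof (rule lborel_pair.Fubini_integrable)
    show "case_prod F \<in> borel_measurable (lborel \<Otimes>\<^sub>M lborel)"
    proof -
      have "case_prod F = (\<lambda>x. h (fst x) * case_prod k x)" by (auto simp: F_def)
      also have "\<dots> \<in> borel_measurable (lborel \<Otimes>\<^sub>M lborel)" using km by measurable
      finally show ?thesis .
    qed
    \<comment> \<open>Since \<open>k\<close> is nonnegative, integrating the norm over
      \<open>t\<close> gives the absolute value of the integral itself, a difference of two
      integrable functions of \<open>s\<close>.\<close>
    have "(\<integral>t. norm (case_prod F (s, t)) \<partial>lborel) = \<bar>indicat_real {0..} s * (exp (- d * s) * f s) - h s\<bar>" for s
    proof (cases "s \<ge> 0")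
      case True
      have "norm (case_prod F (s, t)) = \<bar>h s\<bar> * k s t" for t
        using \<rho> by (simp add: F_def k_def abs_mult)
      moreover have "\<bar>h s\<bar> * (exp (\<rho> * s) - 1) = \<bar>h s * (exp (\<rho> * s) - 1)\<bar>"
        using True \<rho> by (simp add: abs_mult)
      ultimately show ?thesis using k[OF True] hk[of s] by simp
    qed (simp add: F_def h_def)
    then show "integrable lborel (\<lambda>s. \<integral>t. norm (case_prod F (s, t)) \<partial>lborel)"
      using id by simp
    show "AE s in lborel. integrable lborel (\<lambda>t. case_prod F (s, t))"
    proof (rule AE_I2)
      fix s show "integrable lborel (\<lambda>t. case_prod F (s, t))"
        using k(1)[of s] by (cases "s \<ge> 0") (auto simp: F_def h_def)
    qed
  qed
  define G where "G = (\<lambda>t. discounted \<delta> (\<lambda>s. if s < t then 0 else f s))"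
  have FG: "(\<integral>s. F s t \<partial>lborel) = indicat_real {0..} t * (\<rho> * exp (\<rho> * t)) * G t" for t
  proof -
    have "F s t = indicat_real {0..} t * (\<rho> * exp (\<rho> * t)) * (indicat_real {0..} s * (exp (- \<delta> * s) * (if s < t then 0 else f s)))" for s
      by (auto simp: F_def h_def k_def indicator_def)
    then show ?thesis by (simp add: G_def discounted_def set_lebesgue_integral_def)
  qed
  have "0 < (\<integral>t. (\<integral>s. F s t \<partial>lborel) \<partial>lborel)"
    unfolding FG
  proof (rule integral_pos_of_pos_on_interval[OF _ _ e(1)])
    show "integrable lborel (\<lambda>t. indicat_real {0..} t * (\<rho> * exp (\<rho> * t)) * G t)"
      using lborel_pair.integrable_snd[OF FI] by (simp add: FG)
  qed (use tails e(2) \<rho> in \<open>auto simp: G_def indicator_def\<close>)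
  also have "\<dots> = (\<integral>s. (\<integral>t. F s t \<partial>lborel) \<partial>lborel)"
    using lborel_pair.Fubini_integral[OF FI] by simp
  also have "\<dots> = discounted d f - discounted \<delta> f"
    unfolding Fint using id by (simp add: discounted_def set_lebesgue_integral_def h_def)
  \<comment> \<open>The tail from \<open>0\<close> is the whole value at rate
    \<open>\<delta>\<close>, which is nonnegative and is exceeded by the value at rate
    \<open>d\<close>.\<close>
  finally show ?thesis using tails[of 0] by (simp add: discounted_cong[of "\<lambda>s. if s < 0 then 0 else f s" f])
qed

section \<open>Admissible paths and the maximum principle\<close>

locale skill_model =
  fixes M :: model
  assumes valid: "valid_model M"
begin

abbreviation \<alpha> where "\<alpha> \<equiv> alpha M"
abbreviation \<beta> where "\<beta> \<equiv> beta M"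
abbreviation \<gamma> where "\<gamma> \<equiv> gamma M"
abbreviation \<kappa> where "\<kappa> \<equiv> kappa M"
abbreviation \<sigma> where "\<sigma> \<equiv> Sbar M"

lemma pos: "0 < \<alpha>" "0 < \<beta>" "0 < \<gamma>" "0 < \<kappa>" "0 < \<sigma>"
  using valid by (auto simp: valid_model_def)

definition payoff :: "real \<Rightarrow> real \<Rightarrow> (real \<Rightarrow> real) \<Rightarrow> (real \<Rightarrow> real) \<Rightarrow> real" where
  "payoff d w u S = discounted d (\<lambda>t. productivity M (S t) (u t) + w * S t)"

text \<open>The maximizer of \<open>a * v - \<gamma> * v\<^sup>2\<close> over \<open>v \<in> {0..1}\<close>.\<close>

definition best_usage :: "real \<Rightarrow> real" where
  "best_usage a = max 0 (min 1 (a / (2 * \<gamma>)))"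

lemma best_usage_range: "best_usage a \<in> {0..1}"
  by (auto simp: best_usage_def)

lemma best_usage_lipschitz: "\<bar>best_usage a - best_usage b\<bar> \<le> \<bar>a - b\<bar> / (2 * \<gamma>)"
proof -
  have "\<bar>best_usage a - best_usage b\<bar> \<le> \<bar>a / (2 * \<gamma>) - b / (2 * \<gamma>)\<bar>"
    unfolding best_usage_def by linarith
  also have "\<dots> = \<bar>a - b\<bar> / (2 * \<gamma>)" using pos by (simp add: abs_divide flip: diff_divide_distrib)
  finally show ?thesis .
qed

lemma continuous_on_best_usage [continuous_intros]:
  "continuous_on A f \<Longrightarrow> continuous_on A (\<lambda>t. best_usage (f t))"
  unfolding best_usage_def using pos by (intro continuous_intros) auto

text \<open>Variational inequality of a concave problem: the slope of
  \<open>a * v - \<gamma> * v\<^sup>2\<close> at its maximizer does not point towards any feasible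
  \<open>u\<close>. The cases are the lower corner, the interior and the upper corner.\<close>

lemma best_usage_first_order:
  assumes "u \<in> {0..1}"
  shows "0 \<le> (best_usage a - u) * (a - 2 * \<gamma> * best_usage a)"
proof -
  consider "a \<le> 0" | "0 \<le> a" "a \<le> 2 * \<gamma>" | "2 * \<gamma> \<le> a" by linarith
  then show ?thesis
  proof cases
    case 1
    then have "best_usage a = 0" using pos by (auto simp: best_usage_def max_def min_def divide_le_0_iff zero_le_divide_iff)
    then show ?thesis using 1 assms by (simp add: mult_nonneg_nonpos)
  next
    case 2
    then have "best_usage a = a / (2 * \<gamma>)" using pos by (simp add: best_usage_def max_def min_def)
    then show ?thesis using pos by simp
  next
    case 3
    then have "best_usage a = 1" using pos by (simp add: best_usage_def max_def min_def)
    then show ?thesis using 3 assms by simp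
  qed
qed

lemma best_usage_interior:
  assumes "0 < best_usage a" "best_usage a < 1" shows "best_usage a = a / (2 * \<gamma>)"
  using assms by (auto simp: best_usage_def max_def min_def split: if_splits)

text \<open>Classical paths as in \<open>closed_loop\<close>, but with a control depending on time:
  convex combinations of two such pairs are again of this kind, whereas they need not come from a
  feedback.\<close>

definition solves :: "(real \<Rightarrow> real) \<Rightarrow> (real \<Rightarrow> real) \<Rightarrow> bool" where
  "solves u S \<longleftrightarrow> (\<forall>t\<ge>0. u t \<in> {0..1} \<and> S t \<in> {0..\<sigma>} \<and>
     (S has_real_derivative skill_drift M (S t) (u t)) (at t within {0..}))"

definition admissible :: "real \<Rightarrow> (real \<Rightarrow> real) \<Rightarrow> (real \<Rightarrow> real) \<Rightarrow> bool" where
  "admissible x u S \<longleftrightarrow> usage_process u \<and> skill_path M x u S \<and> (\<forall>t\<ge>0. S t \<in> {0..\<sigma>})"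

text \<open>As in \<open>optimal_policy\<close>, competing paths are not asked to stay in
  \<open>{0..\<sigma>}\<close>; the imitating plans used later therefore need no range
  check.\<close>

definition optimal :: "real \<Rightarrow> real \<Rightarrow> real \<Rightarrow> (real \<Rightarrow> real) \<Rightarrow> (real \<Rightarrow> real) \<Rightarrow> bool" where
  "optimal d w x u S \<longleftrightarrow> admissible x u S \<and>
     (\<forall>v T. usage_process v \<and> skill_path M x v T \<longrightarrow> payoff d w v T \<le> payoff d w u S)"

lemma solvesD:
  assumes "solves u S" "t \<ge> 0"
  shows "0 \<le> u t" "u t \<le> 1" "0 \<le> S t" "S t \<le> \<sigma>"
    "(S has_real_derivative skill_drift M (S t) (u t)) (at t within {0..})"
  using assms by (auto simp: solves_def)

lemma solves_continuous: "solves u S \<Longrightarrow> continuous_on {0..} S"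
  by (rule ray_deriv_imp_continuous[OF solvesD(5)])

lemma solves_flow_path:
  assumes "solves u S" shows "flow S"
proof (rule flow_continuous[OF solves_continuous[OF assms]])
  show "\<bar>S t\<bar> \<le> \<sigma>" if "t \<ge> 0" for t using solvesD[OF assms that] by simp
qed

text \<open>The control is measurable because it is an affine function of the path and its derivative.\<close>

lemma solves_flow_usage:
  assumes S: "solves u S" shows "flow u"
proof -
  let ?N = "restrict_space lborel {0..} :: real measure"
  have cont: "g \<in> borel_measurable ?N" if "continuous_on {0..} g" for g :: "real \<Rightarrow> real"
    using borel_measurable_continuous_on_restrict[OF that]
    by (auto simp: borel_measurable_restrict_space_iff)
  \<comment> \<open>Forward difference quotients, so that no time before \<open>0\<close> is
    sampled; their pointwise limit is the drift.\<close>
  define D where "D = (\<lambda>n t. (S (t + 1 / real (Suc n)) - S t) * real (Suc n))"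
  have S_cont: "continuous_on {0..} S" by (rule solves_continuous[OF S])
  have "D n \<in> borel_measurable ?N" for n
    unfolding D_def
    by (rule cont) (intro continuous_intros continuous_on_compose2[OF S_cont] S_cont, auto)
  moreover have "(\<lambda>n. D n t) \<longlonglongrightarrow> skill_drift M (S t) (u t)" if "t \<in> space ?N" for t
  proof -
    have "t \<ge> 0" using that by (simp add: space_restrict_space)
    then have "((\<lambda>y. (S y - S t) / (y - t)) \<longlongrightarrow> skill_drift M (S t) (u t)) (at t within {0..})"
      using solvesD(5)[OF S] by (simp add: has_field_derivative_iff)
    moreover have "filterlim (\<lambda>n. t + 1 / real (Suc n)) (at t within {0..}) sequentially"
      unfolding filterlim_at
    proof
      show "\<forall>\<^sub>F n in sequentially. t + 1 / real (Suc n) \<in> {0..} \<and> t + 1 / real (Suc n) \<noteq> t"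
        using \<open>t \<ge> 0\<close> by (intro always_eventually) auto
      have "(\<lambda>n. t + 1 / real (Suc n)) \<longlonglongrightarrow> t + 0"
        by (intro tendsto_intros LIMSEQ_Suc[OF lim_1_over_n])
      then show "(\<lambda>n. t + 1 / real (Suc n)) \<longlonglongrightarrow> t" by simp
    qed
    ultimately have "((\<lambda>n. (S (t + 1 / real (Suc n)) - S t) / (t + 1 / real (Suc n) - t)) \<longlonglongrightarrow> skill_drift M (S t) (u t))"
      by (rule filterlim_compose)
    then show ?thesis by (simp add: D_def)
  qed
  ultimately have drift: "(\<lambda>t. skill_drift M (S t) (u t)) \<in> borel_measurable ?N"
    by (rule borel_measurable_LIMSEQ_real[rotated])
  have [measurable]: "S \<in> borel_measurable ?N" by (rule cont[OF S_cont])
  have "(\<lambda>t. 1 - S t / \<sigma> - skill_drift M (S t) (u t) / (\<kappa> * \<sigma>)) \<in> borel_measurable ?N"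
    using drift by measurable
  moreover have "(\<lambda>t. 1 - S t / \<sigma> - skill_drift M (S t) (u t) / (\<kappa> * \<sigma>)) = u"
    using pos by (auto simp: skill_drift_def field_simps)
  ultimately show ?thesis
    using solvesD(1,2)[OF S] by (auto simp: flow_def intro!: exI[of _ 1])
qed

lemma usage_process_iff: "usage_process u \<longleftrightarrow> flow u \<and> (\<forall>t\<ge>0. u t \<in> {0..1})"
proof -
  have "\<exists>C. \<forall>t\<ge>0. \<bar>u t\<bar> \<le> C" if "\<forall>t\<ge>0. u t \<in> {0..1}"
    using that by (intro exI[of _ 1]) simp
  then show ?thesis
    unfolding usage_process_def flow_iff_set_measurable by blast
qed

lemma solves_skill_path:
  assumes "solves u S" shows "skill_path M (S 0) u S"
  using ray_FTC[of S "\<lambda>t. skill_drift M (S t) (u t)" 0, OF solvesD(5)[OF assms]] solves_continuous[OF assms]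
  by (simp add: skill_path_def)

lemma solves_admissible: "solves u S \<Longrightarrow> admissible (S 0) u S"
  using solves_skill_path[of u S] solves_flow_usage[of u S]
  by (simp add: admissible_def usage_process_iff solves_def)

lemma closed_loop_solves:
  "closed_loop M \<phi> x S \<Longrightarrow> (\<And>y. y \<in> {0..\<sigma>} \<Longrightarrow> \<phi> y \<in> {0..1}) \<Longrightarrow> solves (\<lambda>t. \<phi> (S t)) S"
  by (auto simp: closed_loop_def solves_def)

lemma closed_loop_optimal:
  assumes "optimal_policy M (payoff d w) \<phi>" "closed_loop M \<phi> x S"
  shows "optimal d w x (\<lambda>t. \<phi> (S t)) S" "solves (\<lambda>t. \<phi> (S t)) S"
proof -
  have "S 0 = x" "x \<in> {0..\<sigma>}" using assms(2) by (auto simp: closed_loop_def)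
  show sol: "solves (\<lambda>t. \<phi> (S t)) S"
    using closed_loop_solves[OF assms(2)] assms(1) by (auto simp: optimal_policy_def)
  show "optimal d w x (\<lambda>t. \<phi> (S t)) S"
    using assms \<open>x \<in> {0..\<sigma>}\<close> solves_admissible[OF sol] \<open>S 0 = x\<close>
    unfolding optimal_def optimal_policy_def by blast
qed

section \<open>Feasible skill paths and their costates\<close>

lemma flow_payoff:
  "flow u \<Longrightarrow> flow S \<Longrightarrow> flow (\<lambda>t. productivity M (S t) (u t) + w * S t)"
  unfolding productivity_def
  by (intro flow_add flow_mult flow_diff flow_const)

text \<open>With the integrating factor \<open>exp (\<kappa> * t)\<close>, both \<open>T\<close> and
  \<open>\<sigma> - T\<close> become nondecreasing because \<open>v\<close> lies in
  \<open>{0..1}\<close>, so neither can turn negative.\<close>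

lemma skill_range:
  assumes T: "\<And>t. t \<ge> 0 \<Longrightarrow> (T has_real_derivative skill_drift M (T t) (v t)) (at t within {0..})"
    and v: "\<And>t. t \<ge> 0 \<Longrightarrow> v t \<in> {0..1}" and "T 0 \<in> {0..\<sigma>}" "t \<ge> 0"
  shows "T t \<in> {0..\<sigma>}"
proof -
  let ?F = "\<lambda>t. exp (\<kappa> * t) * T t" and ?G = "\<lambda>t. exp (\<kappa> * t) * (\<sigma> - T t)"
  have E: "((\<lambda>t. exp (\<kappa> * t)) has_real_derivative \<kappa> * exp (\<kappa> * t)) (at t within {0..})" for t
    by (auto intro!: derivative_eq_intros)
  have "(?F has_real_derivative exp (\<kappa> * t) * (\<kappa> * \<sigma> * (1 - v t))) (at t within {0..})" if "t \<ge> 0" for t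
    by (rule DERIV_cong[OF DERIV_mult[OF E T[OF that]]]) (simp add: skill_drift_def algebra_simps)
  then have "?F 0 \<le> ?F t"
    by (rule ray_mono) (use v pos \<open>t \<ge> 0\<close> in auto)
  moreover have "(?G has_real_derivative exp (\<kappa> * t) * (\<kappa> * \<sigma> * v t)) (at t within {0..})" if "t \<ge> 0" for t
    by (rule DERIV_cong[OF DERIV_mult[OF E DERIV_diff[OF DERIV_const T[OF that]]]])
       (simp add: skill_drift_def algebra_simps)
  then have "?G 0 \<le> ?G t"
    by (rule ray_mono) (use v pos \<open>t \<ge> 0\<close> in auto)
  ultimately have "0 \<le> ?F t" "0 \<le> ?G t" using assms(3) by auto
  then show ?thesis by (auto simp: zero_le_mult_iff)
qed

lemma skill_response:
  assumes "continuous_on {0..} v" and v: "\<And>t. t \<ge> 0 \<Longrightarrow> v t \<in> {0..1}" and "x \<in> {0..\<sigma>}"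
  obtains T where "T 0 = x" "solves v T"
proof -
  have "continuous_on {0..} (\<lambda>t. exp (\<kappa> * t) * (\<kappa> * \<sigma> * (1 - v t)))"
    by (intro continuous_intros assms)
  then obtain I where I: "I 0 = 0"
    "\<And>t. t \<ge> 0 \<Longrightarrow> (I has_real_derivative exp (\<kappa> * t) * (\<kappa> * \<sigma> * (1 - v t))) (at t within {0..})"
    by (rule ray_antiderivative) blast
  define T where "T = (\<lambda>t. exp (- \<kappa> * t) * (x + I t))"
  have T: "(T has_real_derivative skill_drift M (T t) (v t)) (at t within {0..})" if "t \<ge> 0" for t
    unfolding T_def skill_drift_def
    using that by (auto intro!: derivative_eq_intros I simp: algebra_simps exp_minus)
  have "T 0 = x" using I by (simp add: T_def)
  then show ?thesis
    using T skill_range[OF T v] v assms(3) by (intro that[of T]) (auto simp: solves_def)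
qed

text \<open>Existence of a classical bounded costate although \<open>u\<close> need not be continuous: subtracting
  the multiple of \<open>S\<close> whose derivative carries the \<open>u\<close>-term leaves an equation with a
  continuous right-hand side.\<close>

lemma costate_exists:
  assumes S: "solves u S" and "d > 0" "w \<ge> 0"
  obtains l where
    "\<And>t. t \<ge> 0 \<Longrightarrow> (l has_real_derivative (d + \<kappa>) * l t - (1 + (\<beta> - 1) * u t + w)) (at t within {0..})"
    "\<And>t. t \<ge> 0 \<Longrightarrow> min 1 \<beta> / (d + \<kappa>) \<le> l t"
    "\<And>t. t \<ge> 0 \<Longrightarrow> l t \<le> (max 1 \<beta> + w) / (d + \<kappa>)"
proof -
  define r where "r = d + \<kappa>"
  have r: "r > 0" using pos \<open>d > 0\<close> by (simp add: r_def)
  \<comment> \<open>The derivative of \<open>k * S\<close> contains exactly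
    \<open>- (\<beta> - 1) * u\<close>, the possibly discontinuous part of the adjoint equation;
    \<open>Q\<close> is the forcing that remains for \<open>l - k * S\<close>.\<close>
  define k where "k = (\<beta> - 1) / (\<kappa> * \<sigma>)"
  define Q where "Q = (\<lambda>t. 1 + w + (\<beta> - 1) * (1 - S t / \<sigma>) - r * k * S t)"
  have Q_cont: "continuous_on {0..} Q"
    unfolding Q_def using pos by (intro continuous_intros solves_continuous[OF S]) auto
  obtain C where C: "\<And>t. t \<ge> 0 \<Longrightarrow> \<bar>Q t\<bar> \<le> C"
  proof -
    have "flow (\<lambda>t. 1 + w + (\<beta> - 1) * (1 - S t * (1 / \<sigma>)) - r * k * S t)"
      by (intro flow_add flow_mult flow_diff flow_const solves_flow_path[OF S])
    then show ?thesis using that by (auto simp: flow_def Q_def)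
  qed
  obtain z where z: "\<And>t. t \<ge> 0 \<Longrightarrow> (z has_real_derivative r * z t - Q t) (at t within {0..})"
    and zb: "\<And>t. t \<ge> 0 \<Longrightarrow> \<bar>z t\<bar> \<le> C / r"
    using bounded_adjoint_solution[OF Q_cont C r] by blast
  define l where "l = (\<lambda>t. k * S t + z t)"
  let ?q = "\<lambda>t. 1 + (\<beta> - 1) * u t + w"
  have l: "(l has_real_derivative r * l t - ?q t) (at t within {0..})" if "t \<ge> 0" for t
  proof -
    have "(l has_real_derivative k * skill_drift M (S t) (u t) + (r * z t - Q t)) (at t within {0..})"
      unfolding l_def by (intro DERIV_add DERIV_cmult solvesD(5)[OF S that] z[OF that])
    moreover have "k * skill_drift M (S t) (u t) + (r * z t - Q t) = r * l t - ?q t"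
      using pos by (simp add: l_def k_def Q_def skill_drift_def field_simps)
    ultimately show ?thesis by simp
  qed
  have lb: "\<bar>l t\<bar> \<le> \<bar>k\<bar> * \<sigma> + C / r" if "t \<ge> 0" for t
  proof -
    have "\<bar>k * S t\<bar> \<le> \<bar>k\<bar> * \<sigma>" using solvesD[OF S that] by (simp add: abs_mult mult_left_mono)
    then show ?thesis using zb[OF that] unfolding l_def by linarith
  qed
  \<comment> \<open>Apart from \<open>w\<close>, the forcing averages \<open>1\<close> and
    \<open>\<beta>\<close> with weights \<open>1 - u t\<close> and \<open>u t\<close>.\<close>
  have q: "min 1 \<beta> \<le> ?q t" "?q t \<le> max 1 \<beta> + w" if "t \<ge> 0" for t
  proof -
    have "?q t = (1 - u t) * 1 + u t * \<beta> + w" by (simp add: algebra_simps)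
    moreover have "(1 - u t) * min 1 \<beta> + u t * min 1 \<beta> \<le> (1 - u t) * 1 + u t * \<beta>"
      "(1 - u t) * 1 + u t * \<beta> \<le> (1 - u t) * max 1 \<beta> + u t * max 1 \<beta>"
      using solvesD[OF S that] by (intro add_mono mult_left_mono; simp)+
    ultimately show "min 1 \<beta> \<le> ?q t" "?q t \<le> max 1 \<beta> + w"
      using \<open>w \<ge> 0\<close> by (auto simp: algebra_simps)
  qed
  have "- l t \<le> - min 1 \<beta> / r" if "t \<ge> 0" for t
  proof (rule bounded_adjoint_le[where q="\<lambda>t. - ?q t" and z="\<lambda>t. - l t"])
    show "((\<lambda>t. - l t) has_real_derivative r * - l t - - ?q t) (at t within {0..})" if "t \<ge> 0" for t
      using that by (auto intro!: derivative_eq_intros l)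
    show "\<bar>- l t\<bar> \<le> \<bar>k\<bar> * \<sigma> + C / r" if "t \<ge> 0" for t using lb[OF that] by simp
    show "- ?q t \<le> - min 1 \<beta>" if "t \<ge> 0" for t using q[OF that] by simp
  qed fact+
  moreover have "l t \<le> (max 1 \<beta> + w) / r" if "t \<ge> 0" for t
    by (rule bounded_adjoint_le[OF l lb q(2) r that])
  ultimately show ?thesis
    using l by (intro that[of l]) (auto simp: r_def)
qed

lemma discounted_tendsto_0:
  assumes "\<And>t. t \<ge> 0 \<Longrightarrow> \<bar>f t\<bar> \<le> C" "d > 0"
  shows "((\<lambda>t. exp (- d * t) * f t) \<longlongrightarrow> (0::real)) at_top"
proof (rule Lim_null_comparison)
  show "\<forall>\<^sub>F t in at_top. norm (exp (- d * t) * f t) \<le> exp (- d * t) * C"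
    using eventually_ge_at_top[of 0] by eventually_elim (use assms in \<open>simp add: abs_mult\<close>)
  show "((\<lambda>t. exp (- d * t) * C) \<longlongrightarrow> 0) at_top" using \<open>d > 0\<close> by real_asymp
qed

text \<open>Skill depends affinely on the control, so moving \<open>u\<close> towards
  \<open>v\<close> by \<open>\<epsilon>\<close> moves \<open>S\<close> towards its response
  \<open>T\<close> by \<open>\<epsilon>\<close>, and the payoff changes by an exact quadratic
  polynomial in \<open>\<epsilon>\<close>. The sign of the remainder \<open>R\<close> is left open,
  because of the product of skill and usage in productivity; only the first-order gain is
  exploited.\<close>

lemma maximum_principle:
  assumes S: "solves u S" and opt: "optimal d w (S 0) u S" and d: "d > 0" and "w \<ge> 0"
  obtains l where
    "\<And>t. t \<ge> 0 \<Longrightarrow> u t = best_usage (\<alpha> + (\<beta> - 1) * S t - \<kappa> * \<sigma> * l t)"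
    "\<And>t. t \<ge> 0 \<Longrightarrow> (l has_real_derivative (d + \<kappa>) * l t - (1 + (\<beta> - 1) * u t + w)) (at t within {0..})"
    "\<And>t. t \<ge> 0 \<Longrightarrow> min 1 \<beta> / (d + \<kappa>) \<le> l t"
    "\<And>t. t \<ge> 0 \<Longrightarrow> l t \<le> (max 1 \<beta> + w) / (d + \<kappa>)"
proof -
  obtain l where l:
    "\<And>t. t \<ge> 0 \<Longrightarrow> (l has_real_derivative (d + \<kappa>) * l t - (1 + (\<beta> - 1) * u t + w)) (at t within {0..})"
    and l_lo: "\<And>t. t \<ge> 0 \<Longrightarrow> min 1 \<beta> / (d + \<kappa>) \<le> l t"
    and l_hi: "\<And>t. t \<ge> 0 \<Longrightarrow> l t \<le> (max 1 \<beta> + w) / (d + \<kappa>)"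
    by (rule costate_exists[OF S d \<open>w \<ge> 0\<close>]) blast
  have l_cont: "continuous_on {0..} l" by (rule ray_deriv_imp_continuous[OF l])
  define L where "L = (max 1 \<beta> + w) / (d + \<kappa>)"
  have lb: "\<bar>l t\<bar> \<le> L" if "t \<ge> 0" for t
  proof -
    have "0 \<le> min 1 \<beta> / (d + \<kappa>)" using pos d by simp
    then show ?thesis using l_lo[OF that] l_hi[OF that] by (simp add: L_def)
  qed
  have flow_l: "flow l" by (rule flow_continuous[OF l_cont lb])
  define a where "a = (\<lambda>t. \<alpha> + (\<beta> - 1) * S t - \<kappa> * \<sigma> * l t)"
  \<comment> \<open>\<open>v\<close> maximizes the Hamiltonian along the given \<open>S\<close> and
    \<open>l\<close>, not along its own response \<open>T\<close>. It is continuous even if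
    \<open>u\<close> is not, so a classical response exists.\<close>
  define v where "v = (\<lambda>t. best_usage (a t))"
  have v_cont: "continuous_on {0..} v"
    unfolding v_def a_def by (intro continuous_intros solves_continuous[OF S] l_cont)
  have vr: "v t \<in> {0..1}" for t unfolding v_def by (rule best_usage_range)
  obtain T where T0: "T 0 = S 0" and T: "solves v T"
    using skill_response[OF v_cont vr, of "S 0"] solvesD[OF S, of 0] by auto
  define y where "y = (\<lambda>t. T t - S t)"
  define \<eta> where "\<eta> = (\<lambda>t. v t - u t)"
  note flows [intro] = solves_flow_path[OF S] solves_flow_path[OF T] solves_flow_usage[OF S] solves_flow_usage[OF T] flow_l
  have fy [intro]: "flow y" unfolding y_def by blast
  have f\<eta> [intro]: "flow \<eta>" unfolding \<eta>_def by blast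
  have y': "(y has_real_derivative - \<kappa> * \<sigma> * \<eta> t - \<kappa> * y t) (at t within {0..})" if "t \<ge> 0" for t
    unfolding y_def \<eta>_def
    by (rule DERIV_cong[OF DERIV_diff[OF solvesD(5)[OF T that] solvesD(5)[OF S that]]])
       (simp add: skill_drift_def algebra_simps)
  have y0: "y 0 = 0" using T0 by (simp add: y_def)
  have yb: "\<bar>y t\<bar> \<le> \<sigma>" if "t \<ge> 0" for t
    using solvesD[OF S that] solvesD[OF T that] unfolding y_def by auto
  let ?q = "\<lambda>t. 1 + (\<beta> - 1) * u t + w"
  \<comment> \<open>Integrating \<open>l * y\<close> by parts trades the first-order effect of the
    changed skill for \<open>- \<kappa> * \<sigma> * l * \<eta>\<close>, so that only the derivative
    of the Hamiltonian in the control remains.\<close>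
  have adj: "discounted d (\<lambda>t. ?q t * y t + \<kappa> * \<sigma> * l t * \<eta> t) = 0"
  proof -
    have "discounted d (\<lambda>t. ?q t * y t + \<kappa> * \<sigma> * l t * \<eta> t) = - (exp (- d * 0) * (- (l 0 * y 0)))"
    proof (rule discounted_derivative[where F="\<lambda>t. exp (- d * t) * (- (l t * y t))"])
      show "((\<lambda>t. exp (- d * t) * (- (l t * y t))) has_real_derivative
          exp (- d * t) * (?q t * y t + \<kappa> * \<sigma> * l t * \<eta> t)) (at t within {0..})" if "t \<ge> 0" for t
        using that by (auto intro!: derivative_eq_intros l y' simp: algebra_simps)
      show "flow (\<lambda>t. ?q t * y t + \<kappa> * \<sigma> * l t * \<eta> t)" by (intro flow_add flow_mult flow_const flows fy f\<eta>)
      show "((\<lambda>t. exp (- d * t) * (- (l t * y t))) \<longlongrightarrow> 0) at_top"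
      proof (rule discounted_tendsto_0[OF _ d])
        show "\<bar>- (l t * y t)\<bar> \<le> L * \<sigma>" if "t \<ge> 0" for t
          using lb[OF that] yb[OF that] lb[of 0] by (auto simp: abs_mult intro!: mult_mono)
      qed
    qed fact
    then show ?thesis by (simp add: y0)
  qed
  define P where "P = discounted d (\<lambda>t. (\<eta> t)\<^sup>2)"
  define R where "R = discounted d (\<lambda>t. (\<beta> - 1) * y t * \<eta> t - \<gamma> * (\<eta> t)\<^sup>2)"
  have variation: "2 * \<gamma> * P * \<epsilon> + \<epsilon>\<^sup>2 * R \<le> 0" if "0 < \<epsilon>" "\<epsilon> \<le> 1" for \<epsilon>
  proof -
    define ue Se where "ue = (\<lambda>t. u t + \<epsilon> * \<eta> t)" and "Se = (\<lambda>t. S t + \<epsilon> * y t)"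
    have conv: "ue t = (1 - \<epsilon>) * u t + \<epsilon> * v t" "Se t = (1 - \<epsilon>) * S t + \<epsilon> * T t" for t
      by (simp_all add: ue_def Se_def \<eta>_def y_def algebra_simps)
    have sol: "solves ue Se"
      unfolding solves_def
    proof (intro allI impI conjI)
      fix t :: real assume t: "t \<ge> 0"
      note b = solvesD[OF S t] solvesD[OF T t]
      have "0 \<le> (1 - \<epsilon>) * u t + \<epsilon> * v t" "0 \<le> (1 - \<epsilon>) * S t + \<epsilon> * T t" using b that by simp_all
      moreover have "(1 - \<epsilon>) * u t + \<epsilon> * v t \<le> (1 - \<epsilon>) * 1 + \<epsilon> * 1" "(1 - \<epsilon>) * S t + \<epsilon> * T t \<le> (1 - \<epsilon>) * \<sigma> + \<epsilon> * \<sigma>"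
        using b that by (intro add_mono mult_left_mono; simp)+
      ultimately show "ue t \<in> {0..1}" "Se t \<in> {0..\<sigma>}" by (simp_all add: conv algebra_simps)
      show "(Se has_real_derivative skill_drift M (Se t) (ue t)) (at t within {0..})"
        unfolding Se_def ue_def
        by (rule DERIV_cong[OF DERIV_add[OF solvesD(5)[OF S t] DERIV_cmult[OF y'[OF t]]]])
           (simp add: skill_drift_def algebra_simps)
    qed
    have "Se 0 = S 0" by (simp add: Se_def y0)
    then have "admissible (S 0) ue Se" using solves_admissible[OF sol] by simp
    then have "payoff d w ue Se \<le> payoff d w u S"
      using opt by (auto simp: optimal_def admissible_def)
    then have "discounted d (\<lambda>t. (productivity M (Se t) (ue t) + w * Se t) - (productivity M (S t) (u t) + w * S t)) \<le> 0"
      unfolding payoff_def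
      using solves_flow_usage[OF sol] solves_flow_path[OF sol]
      by (subst discounted_diff[OF d]) (auto intro!: flow_payoff)
    also have "(\<lambda>t. (productivity M (Se t) (ue t) + w * Se t) - (productivity M (S t) (u t) + w * S t))
      = (\<lambda>t. \<epsilon> * (?q t * y t + \<kappa> * \<sigma> * l t * \<eta> t) + (\<epsilon> * ((a t - 2 * \<gamma> * u t) * \<eta> t)
            + \<epsilon>\<^sup>2 * ((\<beta> - 1) * y t * \<eta> t - \<gamma> * (\<eta> t)\<^sup>2)))"
      by (auto simp: Se_def ue_def a_def productivity_def power2_eq_square algebra_simps)
    also have "discounted d \<dots> = \<epsilon> * discounted d (\<lambda>t. ?q t * y t + \<kappa> * \<sigma> * l t * \<eta> t)
        + (\<epsilon> * discounted d (\<lambda>t. (a t - 2 * \<gamma> * u t) * \<eta> t) + \<epsilon>\<^sup>2 * R)"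
    proof -
      have split: "discounted d (\<lambda>t. \<epsilon> * X t + (\<epsilon> * Y t + \<epsilon>\<^sup>2 * Z t)) =
          \<epsilon> * discounted d X + (\<epsilon> * discounted d Y + \<epsilon>\<^sup>2 * discounted d Z)"
        if "flow X" "flow Y" "flow Z" for X Y Z
        using that by (simp add: discounted_add[OF d] discounted_cmult)
      show ?thesis
        unfolding R_def a_def
        by (rule split; intro flow_add flow_diff flow_mult flow_const flow_power flows fy f\<eta>)
    qed
    finally have le: "\<epsilon> * discounted d (\<lambda>t. (a t - 2 * \<gamma> * u t) * \<eta> t) + \<epsilon>\<^sup>2 * R \<le> 0"
      by (simp add: adj)
    \<comment> \<open>Writing \<open>u = v - \<eta>\<close> splits the integrand on the right into
      \<open>2 * \<gamma> * \<eta>\<^sup>2\<close> and a term that the variational inequality at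
      \<open>v\<close> makes nonnegative.\<close>
    have "discounted d (\<lambda>t. 2 * \<gamma> * (\<eta> t)\<^sup>2) \<le> discounted d (\<lambda>t. (a t - 2 * \<gamma> * u t) * \<eta> t)"
    proof (rule discounted_mono[OF d])
      show "flow (\<lambda>t. 2 * \<gamma> * (\<eta> t)\<^sup>2)" "flow (\<lambda>t. (a t - 2 * \<gamma> * u t) * \<eta> t)"
        unfolding a_def by (intro flow_add flow_diff flow_mult flow_const flow_power flows f\<eta>)+
      show "2 * \<gamma> * (\<eta> t)\<^sup>2 \<le> (a t - 2 * \<gamma> * u t) * \<eta> t" if "t \<ge> 0" for t
        using best_usage_first_order[of "u t" "a t"] solvesD[OF S that]
        by (simp add: \<eta>_def v_def power2_eq_square algebra_simps)
    qed
    then have "\<epsilon> * (2 * \<gamma> * P) \<le> \<epsilon> * discounted d (\<lambda>t. (a t - 2 * \<gamma> * u t) * \<eta> t)"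
      using that by (simp add: P_def discounted_cmult)
    with le show ?thesis by (simp add: algebra_simps)
  qed
  have P: "P \<le> 0"
  proof (rule ccontr)
    assume "\<not> P \<le> 0"
    then have Pp: "P > 0" by simp
    \<comment> \<open>Small enough that \<open>\<epsilon> * \<bar>R\<bar>\<close> uses up at most
      half of the first-order gain \<open>2 * \<gamma> * P\<close>; the cap \<open>1\<close> keeps
      the combination convex.\<close>
    define \<epsilon> where "\<epsilon> = min 1 (\<gamma> * P / (\<bar>R\<bar> + 1))"
    have \<epsilon>: "0 < \<epsilon>" "\<epsilon> \<le> 1" using Pp pos by (auto simp: \<epsilon>_def)
    have "\<epsilon> * (\<bar>R\<bar> + 1) \<le> \<gamma> * P / (\<bar>R\<bar> + 1) * (\<bar>R\<bar> + 1)"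
      by (intro mult_right_mono) (auto simp: \<epsilon>_def)
    also have "\<dots> = \<gamma> * P" by simp
    finally have "\<epsilon> * \<bar>R\<bar> \<le> \<gamma> * P" using \<epsilon> by (simp add: distrib_left)
    moreover have "- (\<epsilon> * R) \<le> \<epsilon> * \<bar>R\<bar>"
      using \<epsilon> mult_left_mono[of "- R" "\<bar>R\<bar>" \<epsilon>] by simp
    moreover have "\<epsilon> * (2 * \<gamma> * P + \<epsilon> * R) \<le> 0"
      using variation[OF \<epsilon>] by (simp add: power2_eq_square algebra_simps)
    then have "2 * \<gamma> * P + \<epsilon> * R \<le> 0" using \<epsilon> by (simp add: mult_le_0_iff)
    ultimately have "\<gamma> * P \<le> 0" by linarith
    then show False using Pp pos by (simp add: mult_le_0_iff)
  qed
  \<comment> \<open>So far \<open>\<eta>\<close> vanishes only in mean square. Integrating the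
    derivative of the discounted \<open>y\<^sup>2\<close> and completing a square transfers this to
    \<open>y\<close>, which is continuous and hence vanishes everywhere.\<close>
  have energy: "discounted d (\<lambda>t. (d + 2 * \<kappa>) * (y t)\<^sup>2 + 2 * \<kappa> * \<sigma> * y t * \<eta> t) = 0"
  proof -
    have "discounted d (\<lambda>t. (d + 2 * \<kappa>) * (y t)\<^sup>2 + 2 * \<kappa> * \<sigma> * y t * \<eta> t) = - (exp (- d * 0) * (- (y 0)\<^sup>2))"
    proof (rule discounted_derivative[where F="\<lambda>t. exp (- d * t) * (- (y t)\<^sup>2)"])
      show "((\<lambda>t. exp (- d * t) * (- (y t)\<^sup>2)) has_real_derivative
          exp (- d * t) * ((d + 2 * \<kappa>) * (y t)\<^sup>2 + 2 * \<kappa> * \<sigma> * y t * \<eta> t)) (at t within {0..})" if "t \<ge> 0" for t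
        using that by (auto intro!: derivative_eq_intros y' simp: algebra_simps power2_eq_square)
      show "flow (\<lambda>t. (d + 2 * \<kappa>) * (y t)\<^sup>2 + 2 * \<kappa> * \<sigma> * y t * \<eta> t)"
        by (intro flow_add flow_mult flow_const flow_power flows fy f\<eta>)
      show "((\<lambda>t. exp (- d * t) * (- (y t)\<^sup>2)) \<longlongrightarrow> 0) at_top"
      proof (rule discounted_tendsto_0[OF _ d])
        show "\<bar>- (y t)\<^sup>2\<bar> \<le> \<sigma>\<^sup>2" if "t \<ge> 0" for t
          using yb[OF that] pos by (simp add: abs_le_square_iff[symmetric])
      qed
    qed fact
    then show ?thesis by (simp add: y0)
  qed
  have "discounted d (\<lambda>t. (d + \<kappa>) * (y t)\<^sup>2) \<le>
      discounted d (\<lambda>t. ((d + 2 * \<kappa>) * (y t)\<^sup>2 + 2 * \<kappa> * \<sigma> * y t * \<eta> t) + \<kappa> * \<sigma>\<^sup>2 * (\<eta> t)\<^sup>2)"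
  proof (rule discounted_mono[OF d])
    show "(d + \<kappa>) * (y t)\<^sup>2 \<le> ((d + 2 * \<kappa>) * (y t)\<^sup>2 + 2 * \<kappa> * \<sigma> * y t * \<eta> t) + \<kappa> * \<sigma>\<^sup>2 * (\<eta> t)\<^sup>2" for t
    proof -
      have "0 \<le> \<kappa> * (y t + \<sigma> * \<eta> t)\<^sup>2" using pos by simp
      then show ?thesis by (simp add: power2_eq_square algebra_simps)
    qed
  qed (intro flow_add flow_mult flow_const flow_power fy f\<eta>)+
  also have "\<dots> = \<kappa> * \<sigma>\<^sup>2 * P"
    by (subst discounted_add[OF d]) (auto simp: energy P_def discounted_cmult intro!: flow_add flow_mult flow_const flow_power)
  also have "\<dots> \<le> 0" using P pos by (simp add: mult_nonneg_nonpos)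
  finally have y2: "discounted d (\<lambda>t. (y t)\<^sup>2) \<le> 0"
    using d pos by (simp add: discounted_cmult mult_le_0_iff)
  have "continuous_on {0..} (\<lambda>t. (y t)\<^sup>2)"
    unfolding y_def by (intro continuous_intros solves_continuous[OF S] solves_continuous[OF T])
  then have "(y t)\<^sup>2 = 0" if "t \<ge> 0" for t
    using y2 that by (intro continuous_nonneg_discounted_eq_0[of "\<lambda>t. (y t)\<^sup>2" d t] d flow_power fy) auto
  then have y_zero: "y t = 0" if "t \<ge> 0" for t using that by simp
  \<comment> \<open>As \<open>y\<close> is identically zero, so is its derivative; this gives
    \<open>\<eta> t = 0\<close> at every time, including \<open>0\<close>, and not just almost
    everywhere.\<close>
  have "u t = v t" if "t \<ge> 0" for t
  proof -
    have "((\<lambda>_. 0) has_real_derivative - \<kappa> * \<sigma> * \<eta> t - \<kappa> * y t) (at t within {0..})"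
      by (rule has_field_derivative_transform_within[OF y'[OF that] zero_less_one]) (use that y_zero in auto)
    then have "- \<kappa> * \<sigma> * \<eta> t - \<kappa> * y t = 0"
      using ray_deriv_unique[OF _ DERIV_const that] by blast
    then show ?thesis using y_zero[OF that] pos by (simp add: \<eta>_def)
  qed
  then show ?thesis
    using l l_lo l_hi by (intro that[of l]) (auto simp: v_def a_def)
qed

end

section \<open>More patient agents prefer higher skill paths\<close>

lemma flow_exp_decay: "k \<ge> 0 \<Longrightarrow> flow (\<lambda>t. exp (- k * t))"
  by (rule flow_continuous[of _ 1]) (auto intro!: continuous_intros)

context skill_model
begin

lemma admissible_flow:
  assumes "admissible x u S" shows "flow u" "flow S"
proof -
  show "flow u" using assms by (simp add: admissible_def usage_process_iff)
  have "continuous_on {0..} S" "\<And>t. t \<ge> 0 \<Longrightarrow> \<bar>S t\<bar> \<le> \<sigma>"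
    using assms by (auto simp: admissible_def skill_path_def)
  then show "flow S" by (rule flow_continuous)
qed

section \<open>Switching between plans and imitating a plan\<close>

lemma payoff_split:
  assumes "flow u" "flow S" "d > 0"
  shows "payoff d w u S = payoff d 0 u S + w * discounted d S"
proof -
  have "flow (\<lambda>t. productivity M (S t) (u t))" using flow_payoff[OF assms(1,2), of 0] by simp
  then show ?thesis
    unfolding payoff_def using assms by (simp add: discounted_add discounted_cmult)
qed

text \<open>The initial skills \<open>x\<close> and \<open>x'\<close> may differ: only agreement at
  the switching date matters, which lets a plan shifted in skill be joined on later.\<close>

lemma skill_path_switch:
  assumes S: "skill_path M x u S" and T: "skill_path M x' v T" and eq: "S \<tau> = T \<tau>" and "\<tau> \<ge> 0"
  shows "skill_path M x (\<lambda>t. if t < \<tau> then u t else v t) (\<lambda>t. if t < \<tau> then S t else T t)"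
proof -
  let ?u = "\<lambda>t. if t < \<tau> then u t else v t" and ?S = "\<lambda>t. if t < \<tau> then S t else T t"
  let ?f = "\<lambda>s. skill_drift M (S s) (u s)" and ?g = "\<lambda>s. skill_drift M (T s) (v s)"
    and ?h = "\<lambda>s. skill_drift M (?S s) (?u s)"
  have S': "S 0 = x" "continuous_on {0..} S" "\<And>t. t \<ge> 0 \<Longrightarrow> (?f has_integral (S t - x)) {0..t}"
    and T': "T 0 = x'" "continuous_on {0..} T" "\<And>t. t \<ge> 0 \<Longrightarrow> (?g has_integral (T t - x')) {0..t}"
    using S T by (auto simp: skill_path_def)
  have "continuous_on {0..} (\<lambda>t. if t \<le> \<tau> then S t else T t)"
    by (rule continuous_on_cases_le) (auto intro: continuous_on_subset[OF S'(2)] continuous_on_subset[OF T'(2)] simp: eq)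
  also have "(\<lambda>t. if t \<le> \<tau> then S t else T t) = ?S" using eq by auto
  finally have cont: "continuous_on {0..} ?S" .
  have early: "(?h has_integral (S t - x)) {0..t}" if "t \<ge> 0" "t \<le> \<tau>" for t
    by (rule has_integral_spike_finite[OF _ _ S'(3)[OF that(1)], of "{\<tau>}"]) (use that in auto)
  have late: "(?h has_integral (T t - x)) {0..t}" if "t \<ge> \<tau>" for t
  proof -
    have "?g integrable_on {0..t}" "integral {0..t} ?g = T t - x'" "integral {0..\<tau>} ?g = T \<tau> - x'"
      using T'(3)[of t] T'(3)[of \<tau>] that \<open>\<tau> \<ge> 0\<close> by (auto simp: has_integral_iff)
    moreover then have "integral {0..\<tau>} ?g + integral {\<tau>..t} ?g = integral {0..t} ?g"
      using that \<open>\<tau> \<ge> 0\<close> by (intro Henstock_Kurzweil_Integration.integral_combine)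
    moreover have "?g integrable_on {\<tau>..t}"
      using \<open>?g integrable_on {0..t}\<close> by (rule integrable_on_subinterval) (use \<open>\<tau> \<ge> 0\<close> in auto)
    ultimately have "(?g has_integral (T t - T \<tau>)) {\<tau>..t}" by (simp add: has_integral_iff)
    then have "(?h has_integral (T t - T \<tau>)) {\<tau>..t}"
      by (rule has_integral_eq[rotated]) auto
    from has_integral_combine[OF \<open>\<tau> \<ge> 0\<close> that early[OF \<open>\<tau> \<ge> 0\<close> order_refl] this]
    show ?thesis by (simp add: eq)
  qed
  have "(?h has_integral (?S t - x)) {0..t}" if "t \<ge> 0" for t
    using early[OF that] late[of t] by (cases "t < \<tau>") auto
  moreover have "?S 0 = x" using S' eq \<open>\<tau> \<ge> 0\<close> by (cases "\<tau> = 0") auto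
  ultimately show ?thesis using cont unfolding skill_path_def by blast
qed

lemma admissible_switch:
  assumes "admissible x u S" "admissible x' v T" "S \<tau> = T \<tau>" "\<tau> \<ge> 0"
  shows "admissible x (\<lambda>t. if t < \<tau> then u t else v t) (\<lambda>t. if t < \<tau> then S t else T t)"
  using assms skill_path_switch[of x u S x' v T \<tau>]
  by (auto simp: admissible_def usage_process_iff)

text \<open>Drift is affine in skill with slope \<open>- \<kappa>\<close>, so under the same usage a
  skill gap decays exponentially. This is the path of an imitator.\<close>

lemma skill_path_shift:
  assumes "skill_path M x v T"
  shows "skill_path M (x + c) v (\<lambda>s. T s + c * exp (- \<kappa> * s))"
proof -
  have "((\<lambda>s. skill_drift M (T s + c * exp (- \<kappa> * s)) (v s)) has_integral (T t + c * exp (- \<kappa> * t) - (x + c))) {0..t}"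
    if "t \<ge> 0" for t
  proof -
    have "((\<lambda>s. - \<kappa> * c * exp (- \<kappa> * s)) has_integral (c * exp (- \<kappa> * t) - c * exp (- \<kappa> * 0))) {0..t}"
      by (rule ray_FTC[of "\<lambda>s. c * exp (- \<kappa> * s)"]) (use that in \<open>auto intro!: derivative_eq_intros\<close>)
    moreover have "((\<lambda>s. skill_drift M (T s) (v s)) has_integral (T t - x)) {0..t}"
      using assms that by (simp add: skill_path_def)
    ultimately have "((\<lambda>s. skill_drift M (T s) (v s) + - \<kappa> * c * exp (- \<kappa> * s)) has_integral
        (T t - x + (c * exp (- \<kappa> * t) - c * exp (- \<kappa> * 0)))) {0..t}"
      by (intro has_integral_add)
    then show ?thesis by (simp add: skill_drift_def algebra_simps)
  qed
  moreover have "continuous_on {0..} (\<lambda>s. T s + c * exp (- \<kappa> * s))"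
    using assms by (auto simp: skill_path_def intro!: continuous_intros)
  ultimately show ?thesis using assms by (simp add: skill_path_def)
qed

text \<open>The expression is the derivative of productivity in skill at usage \<open>v\<close>, an
  average of \<open>1\<close> and \<open>\<beta>\<close>.\<close>

lemma marginal_skill_pos:
  assumes "v \<in> {0..1}" shows "0 < 1 + (\<beta> - 1) * v"
proof (cases "v = 1")
  case False
  then have "0 < 1 - v" "0 \<le> \<beta> * v" using assms pos by auto
  then show ?thesis by (simp add: algebra_simps)
qed (use pos in simp)

text \<open>From any date \<open>t\<close> on, imitating the lower plan from the higher skill \<open>S t\<close> does at least as
  well as that plan itself, so all tails of the productivity difference are nonnegative.\<close>

lemma patient_prefers_higher_path:
  assumes opt: "optimal \<delta> 0 x u S" and adm: "admissible x v T"
    and le: "\<And>t. t \<ge> 0 \<Longrightarrow> T t \<le> S t" and e: "0 < e" "\<And>t. 0 < t \<Longrightarrow> t < e \<Longrightarrow> T t < S t"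
    and d: "0 < d" "d < \<delta>"
  shows "payoff d 0 v T < payoff d 0 u S"
proof -
  have \<delta>: "\<delta> > 0" using d by simp
  have admS: "admissible x u S" using opt by (simp add: optimal_def)
  note fl = admissible_flow[OF admS] admissible_flow[OF adm]
  have fp: "flow (\<lambda>t. productivity M (S t) (u t))" "flow (\<lambda>t. productivity M (T t) (v t))"
    using flow_payoff[OF fl(1,2), of 0] flow_payoff[OF fl(3,4), of 0] by simp_all
  define f where "f = (\<lambda>t. productivity M (S t) (u t) - productivity M (T t) (v t))"
  have ff: "flow f" unfolding f_def by (intro flow_diff fp)
  \<comment> \<open>What the skill gap at date \<open>t\<close> still earns at date \<open>s\<close>
    when \<open>v\<close> is imitated; this is exact because productivity is affine in
    skill.\<close>
  define g where "g = (\<lambda>t s. (1 + (\<beta> - 1) * v s) * ((S t - T t) * exp (\<kappa> * t) * exp (- \<kappa> * s)))"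
  have fg: "flow (g t)" for t
    unfolding g_def using pos by (intro flow_mult flow_add flow_const fl flow_exp_decay) auto
  have vr: "v s \<in> {0..1}" if "s \<ge> 0" for s
    using adm that by (auto simp: admissible_def usage_process_iff)
  have tail: "discounted \<delta> (\<lambda>s. if s < t then 0 else g t s) \<le> discounted \<delta> (\<lambda>s. if s < t then 0 else f s)"
    if t: "t \<ge> 0" for t
  proof -
    \<comment> \<open>The gap at date \<open>t\<close> rolled back to time \<open>0\<close>, so that
      the shifted path meets \<open>S\<close> at \<open>t\<close>.\<close>
    define c where "c = (S t - T t) * exp (\<kappa> * t)"
    define Y where "Y = (\<lambda>s. T s + c * exp (- \<kappa> * s))"
    let ?v = "\<lambda>s. if s < t then u s else v s" and ?T = "\<lambda>s. if s < t then S s else Y s"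
    have "S t = Y t" by (simp add: Y_def c_def mult.assoc flip: exp_add)
    moreover have "skill_path M (x + c) v Y"
      unfolding Y_def using adm by (intro skill_path_shift) (simp add: admissible_def)
    ultimately have "skill_path M x ?v ?T"
      using admS t by (intro skill_path_switch) (auto simp: admissible_def)
    moreover have "usage_process ?v"
      using admS adm by (auto simp: admissible_def usage_process_iff)
    ultimately have "payoff \<delta> 0 ?v ?T \<le> payoff \<delta> 0 u S"
      using opt by (simp add: optimal_def)
    have fY: "flow Y" unfolding Y_def using pos by (intro flow_add flow_mult flow_const fl flow_exp_decay) auto
    have fc: "flow (\<lambda>s. productivity M (?T s) (?v s))"
      using flow_payoff[of ?v ?T 0] fl fY by simp
    have "discounted \<delta> (\<lambda>s. if s < t then 0 else f s) - discounted \<delta> (\<lambda>s. if s < t then 0 else g t s)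
        = discounted \<delta> (\<lambda>s. (if s < t then 0 else f s) - (if s < t then 0 else g t s))"
      by (intro discounted_diff[symmetric] \<delta> flow_switch flow_const ff fg)
    also have "\<dots> = discounted \<delta> (\<lambda>s. productivity M (S s) (u s) - productivity M (?T s) (?v s))"
      by (rule discounted_cong) (simp add: f_def g_def Y_def c_def productivity_def algebra_simps)
    also have "\<dots> = payoff \<delta> 0 u S - payoff \<delta> 0 ?v ?T"
      unfolding payoff_def using discounted_diff[OF \<delta> fp(1) fc] by simp
    finally show ?thesis using \<open>payoff \<delta> 0 ?v ?T \<le> payoff \<delta> 0 u S\<close> by simp
  qed
  have g_nonneg: "0 \<le> g t s" if "t \<ge> 0" "s \<ge> 0" for t s
    unfolding g_def using marginal_skill_pos[OF vr[OF that(2)]] le[OF that(1)] by simp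
  have "0 < discounted d f"
  proof (rule discounted_pos_of_tails[OF ff d])
    show "0 \<le> discounted \<delta> (\<lambda>s. if s < t then 0 else f s)" if "t \<ge> 0" for t
    proof -
      have "0 \<le> discounted \<delta> (\<lambda>s. if s < t then 0 else g t s)"
        by (rule discounted_nonneg) (use g_nonneg that \<delta> in \<open>auto intro!: flow_switch fg\<close>)
      with tail[OF that] show ?thesis by simp
    qed
    show "0 < discounted \<delta> (\<lambda>s. if s < t then 0 else f s)" if "0 < t" "t < e" for t
    proof -
      have "0 < discounted \<delta> (\<lambda>s. if s < t then 0 else g t s)"
      proof (rule discounted_pos[of _ _ t "t + 1"])
        show "0 < (if s < t then 0 else g t s)" if "t < s" for s
          using marginal_skill_pos[OF vr[of s]] e(2)[OF \<open>0 < t\<close> \<open>t < e\<close>] that \<open>0 < t\<close> by (simp add: g_def)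
      qed (use g_nonneg that \<delta> in \<open>auto intro!: flow_switch fg\<close>)
      with tail[of t] that show ?thesis by simp
    qed
  qed (rule e)
  also have "discounted d f = payoff d 0 u S - payoff d 0 v T"
    unfolding payoff_def f_def using discounted_diff[OF d(1) fp] by simp
  finally show ?thesis by simp
qed

text \<open>Exchange argument: up to the first time the two paths meet again, the impatient agent would
  compare its own segment with the patient agent's segment and conversely.\<close>

lemma impatient_path_not_higher:
  assumes F: "optimal \<delta> 0 x uF F" and W: "optimal d w x uW W" and w: "w \<ge> 0" and d: "0 < d" "d < \<delta>"
    and e: "0 < e" and lt: "\<And>t. 0 < t \<Longrightarrow> t < e \<Longrightarrow> W t < F t"
  shows False
proof -
  have aF: "admissible x uF F" and aW: "admissible x uW W" using F W by (auto simp: optimal_def)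
  note fl = admissible_flow[OF aF] admissible_flow[OF aW]
  have cont: "continuous_on {0..} F" "continuous_on {0..} W" and init: "F 0 = x" "W 0 = x"
    using aF aW by (auto simp: admissible_def skill_path_def)
  \<comment> \<open>\<open>T1\<close> and \<open>T2\<close> are \<open>W\<close> and
    \<open>F\<close> with segments exchanged, so what the worker loses from \<open>F\<close> to
    \<open>T1\<close> equals what it gains from \<open>W\<close> to \<open>T2\<close>. The loss is
    positive because \<open>T1\<close> lies below \<open>F\<close>, while the gain cannot be, by
    optimality of \<open>W\<close>. The term in \<open>w\<close> only adds to the loss.\<close>
  have swap: False
    if a1: "admissible x v1 T1" and a2: "admissible x v2 T2" and e': "0 < e'" "\<And>t. 0 < t \<Longrightarrow> t < e' \<Longrightarrow> T1 t < F t"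
      and le: "\<And>t. t \<ge> 0 \<Longrightarrow> T1 t \<le> F t"
      and sw: "\<And>t. t \<ge> 0 \<Longrightarrow> (T1 t = W t \<and> v1 t = uW t \<and> T2 t = F t \<and> v2 t = uF t)
        \<or> (T1 t = F t \<and> v1 t = uF t \<and> T2 t = W t \<and> v2 t = uW t)"
    for v1 T1 v2 T2 e'
  proof -
    note fl' = admissible_flow[OF a1] admissible_flow[OF a2]
    have "payoff d 0 v1 T1 < payoff d 0 uF F"
      by (rule patient_prefers_higher_path[OF F a1 le e' d])
    moreover have "discounted d T1 \<le> discounted d F"
      by (rule discounted_mono[OF d(1) fl'(2) fl(2) le])
    then have "w * discounted d T1 \<le> w * discounted d F" by (rule mult_left_mono[OF _ w])
    ultimately have "payoff d w v1 T1 < payoff d w uF F"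
      using payoff_split[OF fl(1,2) d(1), of w] payoff_split[OF fl'(1,2) d(1), of w] by linarith
    moreover have "payoff d w uF F - payoff d w v1 T1 = payoff d w v2 T2 - payoff d w uW W"
    proof -
      have "payoff d w uF F - payoff d w v1 T1 = discounted d (\<lambda>t. (productivity M (F t) (uF t) + w * F t)
          - (productivity M (T1 t) (v1 t) + w * T1 t))"
        unfolding payoff_def by (intro discounted_diff[symmetric] d flow_payoff fl fl')
      also have "\<dots> = discounted d (\<lambda>t. (productivity M (T2 t) (v2 t) + w * T2 t)
          - (productivity M (W t) (uW t) + w * W t))"
        by (rule discounted_cong) (use sw in fastforce)
      also have "\<dots> = payoff d w v2 T2 - payoff d w uW W"
        unfolding payoff_def by (intro discounted_diff d flow_payoff fl fl')
      finally show ?thesis .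
    qed
    moreover have "payoff d w v2 T2 \<le> payoff d w uW W"
      using W a2 by (simp add: optimal_def admissible_def)
    ultimately show False by simp
  qed
  show False
  proof (cases "\<forall>t>0. W t < F t")
    case True
    show False
    proof (rule swap[OF aW aF e])
      show "W t < F t" if "0 < t" for t using True that by simp
      show "W t \<le> F t" if "t \<ge> 0" for t using True init that by (cases "t = 0") (auto simp: less_imp_le)
    qed simp
  next
    case False
    then obtain t1 where t1: "0 < t1" "F t1 \<le> W t1" by (auto simp: not_less)
    then have "e \<le> t1" using lt[of t1] by (auto simp: not_less[symmetric])
    \<comment> \<open>Both paths start at \<open>x\<close>, so the first later meeting is sought
      from \<open>e/2\<close> on, where they are still strictly apart.\<close>
    define Z where "Z = {t \<in> {e/2..t1}. F t = W t}"
    have meet: "\<exists>s\<in>{e/2..t}. F s = W s" if "e/2 \<le> t" "F t \<le> W t" for t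
    proof -
      have "\<exists>s\<ge>e/2. s \<le> t \<and> (\<lambda>s. W s - F s) s = 0"
        using that e lt[of "e/2"]
        by (intro IVT') (auto intro!: continuous_intros continuous_on_subset[OF cont(1)] continuous_on_subset[OF cont(2)])
      then show ?thesis by force
    qed
    have "closed Z"
      unfolding Z_def
      by (rule continuous_closed_preimage_constant[of _ "\<lambda>t. F t - W t" 0, simplified])
         (use e in \<open>auto intro!: continuous_intros continuous_on_subset[OF cont(1)] continuous_on_subset[OF cont(2)]\<close>)
    moreover have "Z \<noteq> {}" using meet[of t1] t1 \<open>e \<le> t1\<close> e by (auto simp: Z_def)
    moreover have bdd: "bdd_below Z" by (rule bdd_belowI[of _ "e/2"]) (auto simp: Z_def)
    ultimately have "Inf Z \<in> Z" using closed_contains_Inf[of Z] by blast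
    define \<tau> where "\<tau> = Inf Z"
    have \<tau>: "e/2 \<le> \<tau>" "\<tau> \<le> t1" "F \<tau> = W \<tau>" using \<open>Inf Z \<in> Z\<close> by (auto simp: \<tau>_def Z_def)
    have before: "W t < F t" if "0 < t" "t < \<tau>" for t
    proof (cases "t < e/2")
      case True then show ?thesis using lt[of t] that e by simp
    next
      case False
      show ?thesis
      proof (rule ccontr)
        assume "\<not> ?thesis"
        then obtain s where "s \<in> {e/2..t}" "F s = W s" using meet[of t] False by auto
        then have "s \<in> Z" using that \<tau> by (auto simp: Z_def)
        then have "\<tau> \<le> s" unfolding \<tau>_def by (rule cInf_lower[OF _ bdd])
        then show False using \<open>s \<in> {e/2..t}\<close> that by simp
      qed
    qed
    have "\<tau> \<ge> 0" "\<tau> > 0" using \<tau> e by auto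
    show False
    proof (rule swap[OF admissible_switch[OF aW aF \<tau>(3)[symmetric] \<open>\<tau> \<ge> 0\<close>] admissible_switch[OF aF aW \<tau>(3) \<open>\<tau> \<ge> 0\<close>] \<open>\<tau> > 0\<close>])
      show "(if t < \<tau> then W t else F t) < F t" if "0 < t" "t < \<tau>" for t using before that by simp
      show "(if t < \<tau> then W t else F t) \<le> F t" if "t \<ge> 0" for t
        using before[of t] init that by (cases "t = 0") (auto simp: less_imp_le)
    qed auto
  qed
qed

text \<open>Lower usage by the firm at \<open>x\<close> would lift its path above the worker's right
  after time \<open>0\<close>, which the exchange argument excludes. Equal usages give equal initial
  directions; at interior points the comparison then moves up one order, to the derivatives of the
  costates.\<close>

lemma impatience_raises_usage:
  assumes F: "optimal_policy M (payoff \<delta> 0) uF" and W: "optimal_policy M (payoff d w) uW"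
    and w: "w \<ge> 0" and d: "0 < d" "d < \<delta>" and x: "x \<in> {0..\<sigma>}"
  shows "uW x \<le> uF x" "interior_at uF x \<Longrightarrow> interior_at uW x \<Longrightarrow> uW x < uF x"
proof -
  obtain SF SW where cl: "closed_loop M uF x SF" "closed_loop M uW x SW"
    using F W x unfolding optimal_policy_def by blast
  note oF = closed_loop_optimal[OF F cl(1)] and oW = closed_loop_optimal[OF W cl(2)]
  have init: "SF 0 = x" "SW 0 = x" using cl by (auto simp: closed_loop_def)
  note contra = impatient_path_not_higher[OF oF(1) oW(1) w d]
  let ?D = "\<lambda>t. SF t - SW t"
  have D': "(?D has_real_derivative \<kappa> * \<sigma> * (uW (SW t) - uF (SF t)) - \<kappa> * ?D t) (at t within {0..})" if "t \<ge> 0" for t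
    by (rule DERIV_cong[OF DERIV_diff[OF solvesD(5)[OF oF(2) that] solvesD(5)[OF oW(2) that]]])
       (simp add: skill_drift_def algebra_simps)
  show weak: "uW x \<le> uF x"
  proof (rule ccontr)
    assume "\<not> ?thesis"
    then have "0 < \<kappa> * \<sigma> * (uW (SW 0) - uF (SF 0)) - \<kappa> * ?D 0"
      using pos by (simp add: init)
    from has_real_derivative_pos_inc_right[OF D'[of 0] this]
    obtain e where "e > 0" "\<And>h. 0 < h \<Longrightarrow> h < e \<Longrightarrow> ?D 0 < ?D (0 + h)" by auto
    then show False using contra[of e] by (simp add: init)
  qed
  assume int: "interior_at uF x" "interior_at uW x"
  show "uW x < uF x"
  proof (rule ccontr)
    assume "\<not> ?thesis"
    then have eq: "uF x = uW x" using weak by simp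
    have opt0: "optimal \<delta> 0 (SF 0) (\<lambda>t. uF (SF t)) SF" "optimal d w (SW 0) (\<lambda>t. uW (SW t)) SW"
      using oF(1) oW(1) by (simp_all add: init)
    have \<delta>: "\<delta> > 0" using d by simp
    obtain lF where lF: "\<And>t. t \<ge> 0 \<Longrightarrow> uF (SF t) = best_usage (\<alpha> + (\<beta> - 1) * SF t - \<kappa> * \<sigma> * lF t)"
      "\<And>t. t \<ge> 0 \<Longrightarrow> (lF has_real_derivative (\<delta> + \<kappa>) * lF t - (1 + (\<beta> - 1) * uF (SF t) + 0)) (at t within {0..})"
      by (rule maximum_principle[OF oF(2) opt0(1) \<delta> order_refl]) blast
    obtain lW where lW: "\<And>t. t \<ge> 0 \<Longrightarrow> uW (SW t) = best_usage (\<alpha> + (\<beta> - 1) * SW t - \<kappa> * \<sigma> * lW t)"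
      "\<And>t. t \<ge> 0 \<Longrightarrow> (lW has_real_derivative (d + \<kappa>) * lW t - (1 + (\<beta> - 1) * uW (SW t) + w)) (at t within {0..})"
      and lW_lo: "\<And>t. t \<ge> 0 \<Longrightarrow> min 1 \<beta> / (d + \<kappa>) \<le> lW t"
      by (rule maximum_principle[OF oW(2) opt0(2) d(1) w]) blast
    define aF where "aF = (\<lambda>t. \<alpha> + (\<beta> - 1) * SF t - \<kappa> * \<sigma> * lF t)"
    define aW where "aW = (\<lambda>t. \<alpha> + (\<beta> - 1) * SW t - \<kappa> * \<sigma> * lW t)"
    have u0: "best_usage (aF 0) = uF x" "best_usage (aW 0) = uW x"
      using lF(1)[of 0] lW(1)[of 0] by (simp_all add: aF_def aW_def init)
    have "aF 0 / (2 * \<gamma>) = aW 0 / (2 * \<gamma>)"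
      using best_usage_interior[of "aF 0"] best_usage_interior[of "aW 0"] int eq u0 by (simp add: interior_at_def)
    then have l0: "lF 0 = lW 0" using pos by (simp add: aF_def aW_def init)
    have "lW 0 > 0"
    proof -
      have "0 < min 1 \<beta> / (d + \<kappa>)" using pos d by simp
      then show ?thesis using lW_lo[of 0] by simp
    qed
    \<comment> \<open>Skill, usage and costate agree at time \<open>0\<close>, so only the discount
      rates and \<open>w\<close> survive in the difference of the derivatives.\<close>
    let ?A = "\<lambda>t. aW t - aF t"
    have A': "(?A has_real_derivative \<kappa> * \<sigma> * ((\<delta> - d) * lW 0 + w)) (at 0 within {0..})"
      unfolding aF_def aW_def
      by (rule DERIV_cong[OF DERIV_diff[OF
              DERIV_diff[OF DERIV_add[OF DERIV_const DERIV_cmult[OF solvesD(5)[OF oW(2)]]] DERIV_cmult[OF lW(2)]]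
              DERIV_diff[OF DERIV_add[OF DERIV_const DERIV_cmult[OF solvesD(5)[OF oF(2)]]] DERIV_cmult[OF lF(2)]]]])
         (auto simp: skill_drift_def init eq l0 algebra_simps)
    have "0 < \<kappa> * \<sigma> * ((\<delta> - d) * lW 0 + w)"
      using pos d w \<open>lW 0 > 0\<close> by (simp add: add_pos_nonneg)
    from has_real_derivative_pos_inc_right[OF A' this]
    obtain e1 where e1: "e1 > 0" "\<And>h. 0 < h \<Longrightarrow> h < e1 \<Longrightarrow> ?A 0 < ?A (0 + h)" by auto
    have "?A 0 = 0" by (simp add: aF_def aW_def init l0)
    have contF: "continuous_on {0..} (\<lambda>t. best_usage (aF t))"
      unfolding aF_def
      by (intro continuous_intros solves_continuous[OF oF(2)] ray_deriv_imp_continuous[OF lF(2)])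
    have contW: "continuous_on {0..} (\<lambda>t. best_usage (aW t))"
      unfolding aW_def
      by (intro continuous_intros solves_continuous[OF oW(2)] ray_deriv_imp_continuous[OF lW(2)])
    \<comment> \<open>\<open>best_usage\<close> is strictly increasing only away from its corners,
      so interiority must persist for a while.\<close>
    have "\<forall>\<^sub>F t in at 0 within {0..}. 0 < best_usage (aF t) \<and> best_usage (aF t) < 1 \<and> 0 < best_usage (aW t) \<and> best_usage (aW t) < 1"
    proof -
      have lim: "((\<lambda>t. best_usage (aF t)) \<longlongrightarrow> uF x) (at 0 within {0..})" "((\<lambda>t. best_usage (aW t)) \<longlongrightarrow> uW x) (at 0 within {0..})"
        using contF[unfolded continuous_on_def, rule_format, of 0] contW[unfolded continuous_on_def, rule_format, of 0] u0
        by simp_all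
      show ?thesis
        using int by (intro eventually_conj order_tendstoD[OF lim(1)] order_tendstoD[OF lim(2)]) (auto simp: interior_at_def)
    qed
    then obtain e2 where e2: "e2 > 0" "\<And>t. 0 < t \<Longrightarrow> t < e2 \<Longrightarrow>
        0 < best_usage (aF t) \<and> best_usage (aF t) < 1 \<and> 0 < best_usage (aW t) \<and> best_usage (aW t) < 1"
      unfolding eventually_at by (auto simp: dist_real_def)
    have uless: "uF (SF t) < uW (SW t)" if "0 < t" "t < min e1 e2" for t
    proof -
      have "aF t < aW t" using e1(2)[of t] that \<open>?A 0 = 0\<close> by simp
      then have "aF t / (2 * \<gamma>) < aW t / (2 * \<gamma>)" using pos by (simp add: divide_strict_right_mono)
      then show ?thesis
        using best_usage_interior[of "aF t"] best_usage_interior[of "aW t"] e2(2)[of t] that lF(1)[of t] lW(1)[of t]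
        by (simp add: aF_def aW_def)
    qed
    show False
    proof (rule contra)
      show "0 < min e1 e2" using e1 e2 by simp
      fix t assume t: "0 < t" "t < min e1 e2"
      have E: "((\<lambda>t. exp (\<kappa> * t)) has_real_derivative \<kappa> * exp (\<kappa> * t)) (at t within {0..})" for t
        by (auto intro!: derivative_eq_intros)
      \<comment> \<open>The derivative of \<open>?D\<close> vanishes at time \<open>0\<close>, so
        its sign is obtained from usage at positive times, with the decay term absorbed by the
        integrating factor.\<close>
      have "((\<lambda>t. exp (\<kappa> * t) * ?D t) has_real_derivative exp (\<kappa> * t) * (\<kappa> * \<sigma> * (uW (SW t) - uF (SF t)))) (at t within {0..})"
        if "t \<ge> 0" for t
        by (rule DERIV_cong[OF DERIV_mult[OF E D'[OF that]]]) (simp add: algebra_simps)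
      then have "exp (\<kappa> * 0) * ?D 0 < exp (\<kappa> * t) * ?D t"
        by (rule ray_strict_mono) (use t uless pos in auto)
      then show "SW t < SF t" by (simp add: init zero_less_mult_iff)
    qed
  qed
qed

end

section \<open>The myopic limit\<close>

lemma discounted_exp_decay:
  assumes "d > 0" "k \<ge> 0" shows "discounted d (\<lambda>t. exp (- k * t)) = 1 / (d + k)"
proof -
  define r where "r = d + k"
  have r: "r > 0" using assms by (simp add: r_def)
  have "discounted d (\<lambda>t. exp (- k * t)) = - (- 1 / r * exp (- r * 0))"
  proof (rule discounted_derivative[where F="\<lambda>t. - 1 / r * exp (- r * t)"])
    show "((\<lambda>t. - 1 / r * exp (- r * t)) has_real_derivative exp (- d * t) * exp (- k * t)) (at t within {0..})" for t
    proof -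
      have "((\<lambda>t. - 1 / r * exp (- r * t)) has_real_derivative exp (- r * t)) (at t within {0..})"
        using r by (auto intro!: derivative_eq_intros)
      then show ?thesis by (simp add: r_def algebra_simps flip: exp_add)
    qed
    show "((\<lambda>t. - 1 / r * exp (- r * t)) \<longlongrightarrow> 0) at_top" using r by real_asymp
  qed (use assms flow_exp_decay in auto)
  then show ?thesis by (simp add: r_def)
qed

context skill_model
begin

lemma productivity_alt: "productivity M x v = x + (\<alpha> + (\<beta> - 1) * x) * v - \<gamma> * v\<^sup>2"
  by (simp add: productivity_def power2_eq_square algebra_simps)

text \<open>Strict concavity in usage: a deviation from the maximizer costs at least
  \<open>\<gamma>\<close> times its square, so the maximizer is unique.\<close>

lemma myopic_policy_eq:
  assumes "myopic_policy M m" "x \<in> {0..\<sigma>}"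
  shows "m x = best_usage (\<alpha> + (\<beta> - 1) * x)"
proof -
  define a where "a = \<alpha> + (\<beta> - 1) * x"
  have m: "m x \<in> {0..1}" "productivity M x (best_usage a) \<le> productivity M x (m x)"
    using assms best_usage_range[of a] by (auto simp: myopic_policy_def)
  have "(best_usage a - m x) * (a - 2 * \<gamma> * best_usage a) + \<gamma> * (best_usage a - m x)\<^sup>2
      = productivity M x (best_usage a) - productivity M x (m x)"
    by (simp add: productivity_alt a_def power2_eq_square algebra_simps)
  then have "\<gamma> * (best_usage a - m x)\<^sup>2 \<le> 0"
    using m best_usage_first_order[OF m(1), of a] by linarith
  then have "(best_usage a - m x)\<^sup>2 \<le> 0" using pos by (simp add: mult_le_0_iff)
  then show ?thesis by (simp add: a_def)
qed

lemma productivity_bounded: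
  assumes "x \<in> {0..\<sigma>}" "v \<in> {0..1}"
  shows "\<bar>productivity M x v\<bar> \<le> \<sigma> + (\<alpha> + \<bar>\<beta> - 1\<bar> * \<sigma>) + \<gamma>"
proof -
  have "\<bar>(\<beta> - 1) * x\<bar> \<le> \<bar>\<beta> - 1\<bar> * \<sigma>" using assms by (simp add: abs_mult mult_left_mono)
  then have "\<bar>\<alpha> + (\<beta> - 1) * x\<bar> \<le> \<alpha> + \<bar>\<beta> - 1\<bar> * \<sigma>" using pos by linarith
  then have 1: "\<bar>(\<alpha> + (\<beta> - 1) * x) * v\<bar> \<le> (\<alpha> + \<bar>\<beta> - 1\<bar> * \<sigma>) * 1"
    unfolding abs_mult using assms pos by (intro mult_mono) auto
  have "v\<^sup>2 \<le> 1" using assms by (simp add: power_le_one)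
  then have 2: "0 \<le> \<gamma> * v\<^sup>2" "\<gamma> * v\<^sup>2 \<le> \<gamma>" using pos by (simp_all add: mult_left_le)
  have "\<bar>x + z - y\<bar> \<le> \<sigma> + A + \<gamma>" if "\<bar>z\<bar> \<le> A" "0 \<le> y" "y \<le> \<gamma>" for z y A
    using assms that by auto
  from this[OF _ 2] 1 show ?thesis unfolding productivity_alt by simp
qed

text \<open>The two feedback rules differ only by the costate term, a perturbation of order
  \<open>L\<close> of a Lipschitz equation. \<open>B\<close> and \<open>K\<close> are fixed before
  \<open>L\<close>, so the estimate vanishes with \<open>L\<close> at each fixed time, uniformly
  over all optimal paths.\<close>

lemma small_costate_tracks_myopic:
  obtains B K where "B \<ge> 0"
    "\<And>u S p P l L t. solves u S \<Longrightarrow> solves p P \<Longrightarrow> S 0 = P 0 \<Longrightarrow> L \<ge> 0 \<Longrightarrow>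
      (\<And>t. t \<ge> 0 \<Longrightarrow> u t = best_usage (\<alpha> + (\<beta> - 1) * S t - \<kappa> * \<sigma> * l t)) \<Longrightarrow>
      (\<And>t. t \<ge> 0 \<Longrightarrow> p t = best_usage (\<alpha> + (\<beta> - 1) * P t)) \<Longrightarrow>
      (\<And>t. t \<ge> 0 \<Longrightarrow> \<bar>l t\<bar> \<le> L) \<Longrightarrow> t \<ge> 0 \<Longrightarrow>
      \<bar>productivity M (S t) (u t) - productivity M (P t) (p t)\<bar> \<le> B * L * exp (K * t)"
proof -
  define k where "k = \<kappa> * \<sigma>"
  define b where "b = \<bar>\<beta> - 1\<bar>"
  \<comment> \<open>\<open>k * b / \<gamma>\<close> is twice the Lipschitz constant of the usage
    term in the drift, as squares are differentiated; the \<open>1\<close> pays for splitting the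
    cross term. Below, \<open>A2\<close> bounds the slope of productivity in usage,
    \<open>A3\<close> the response of usage to skill gap and costate, and \<open>A4 * L\<close> is
    the forcing.\<close>
  define K where "K = k * b / \<gamma> + 1"
  define A2 where "A2 = b * \<sigma> + \<alpha> + 2 * \<gamma>"
  define A3 where "A3 = (b + k) / (2 * \<gamma>)"
  define A4 where "A4 = k * k / (2 * \<gamma>)"
  define B where "B = (1 + b + A2 * A3) * (A4 + 1)"
  have nn: "k > 0" "b \<ge> 0" "A2 \<ge> 0" "A3 \<ge> 0" "A4 \<ge> 0" "K \<ge> 1"
    using pos by (auto simp: k_def b_def K_def A2_def A3_def A4_def)
  have "B \<ge> 0" unfolding B_def using nn by simp
  moreover
  have "\<bar>productivity M (S t) (u t) - productivity M (P t) (p t)\<bar> \<le> B * L * exp (K * t)"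
    if S: "solves u S" and P: "solves p P" and init: "S 0 = P 0" and L: "L \<ge> 0"
      and u: "\<And>t. t \<ge> 0 \<Longrightarrow> u t = best_usage (\<alpha> + (\<beta> - 1) * S t - \<kappa> * \<sigma> * l t)"
      and p: "\<And>t. t \<ge> 0 \<Longrightarrow> p t = best_usage (\<alpha> + (\<beta> - 1) * P t)"
      and l: "\<And>t. t \<ge> 0 \<Longrightarrow> \<bar>l t\<bar> \<le> L" and t: "t \<ge> 0"
    for u S p P l L t
  proof -
    let ?D = "\<lambda>t. S t - P t"
    have du: "\<bar>u t - p t\<bar> \<le> (b * \<bar>?D t\<bar> + k * L) / (2 * \<gamma>)" if "t \<ge> 0" for t
    proof -
      have "\<bar>u t - p t\<bar> \<le> \<bar>(\<alpha> + (\<beta> - 1) * S t - \<kappa> * \<sigma> * l t) - (\<alpha> + (\<beta> - 1) * P t)\<bar> / (2 * \<gamma>)"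
        unfolding u[OF that] p[OF that] by (rule best_usage_lipschitz)
      also have "(\<alpha> + (\<beta> - 1) * S t - \<kappa> * \<sigma> * l t) - (\<alpha> + (\<beta> - 1) * P t) = (\<beta> - 1) * ?D t - k * l t"
        by (simp add: k_def algebra_simps)
      also have "\<bar>(\<beta> - 1) * ?D t - k * l t\<bar> \<le> b * \<bar>?D t\<bar> + k * \<bar>l t\<bar>"
        unfolding b_def using nn abs_triangle_ineq4[of "(\<beta> - 1) * ?D t" "k * l t"] by (simp add: abs_mult)
      also have "\<dots> \<le> b * \<bar>?D t\<bar> + k * L" using l[OF that] nn by simp
      finally show ?thesis using pos by (simp add: divide_right_mono)
    qed
    define e where "e = k * k * L / (2 * \<gamma>)"
    have "e \<ge> 0" using L pos nn by (simp add: e_def)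
    have D': "(?D has_real_derivative k * (p t - u t) - \<kappa> * ?D t) (at t within {0..})" if "t \<ge> 0" for t
      by (rule DERIV_cong[OF DERIV_diff[OF solvesD(5)[OF S that] solvesD(5)[OF P that]]])
         (simp add: skill_drift_def k_def algebra_simps)
    have X': "((\<lambda>t. (?D t)\<^sup>2) has_real_derivative 2 * ?D t * (k * (p t - u t) - \<kappa> * ?D t)) (at t within {0..})" if "t \<ge> 0" for t
      by (rule DERIV_cong[OF DERIV_power[OF D'[OF that], of 2]]) (simp add: algebra_simps)
    have X_le: "2 * ?D t * (k * (p t - u t) - \<kappa> * ?D t) \<le> K * (?D t)\<^sup>2 + e\<^sup>2" if "t \<ge> 0" for t
    proof -
      let ?d = "\<bar>?D t\<bar>"
      have "2 * ?D t * (k * (p t - u t) - \<kappa> * ?D t) = 2 * k * (?D t * (p t - u t)) - 2 * \<kappa> * (?D t)\<^sup>2"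
        by (simp add: power2_eq_square algebra_simps)
      also have "\<dots> \<le> 2 * k * (?D t * (p t - u t))" using pos by simp
      also have "\<dots> \<le> 2 * k * (?d * \<bar>u t - p t\<bar>)"
      proof (intro mult_left_mono)
        show "?D t * (p t - u t) \<le> ?d * \<bar>u t - p t\<bar>"
          by (metis abs_ge_self abs_minus_commute abs_mult)
      qed (use nn in simp)
      also have "\<dots> \<le> 2 * k * (?d * ((b * ?d + k * L) / (2 * \<gamma>)))"
        using du[OF that] nn by (intro mult_left_mono) auto
      also have "\<dots> = (K - 1) * ?d\<^sup>2 + 2 * ?d * e"
        using pos by (simp add: K_def e_def field_simps power2_eq_square)
      also have "\<dots> \<le> (K - 1) * ?d\<^sup>2 + (?d\<^sup>2 + e\<^sup>2)"
        using sum_squares_bound[of ?d e] by simp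
      finally show ?thesis by (simp add: algebra_simps)
    qed
    have "(?D t)\<^sup>2 \<le> e\<^sup>2 * exp (K * t)"
      using gronwall_square[OF X' X_le _ nn(6) t] init by simp
    also have "\<dots> \<le> e\<^sup>2 * (exp (K * t) * exp (K * t))"
      using nn t by (intro mult_left_mono) auto
    also have "\<dots> = (e * exp (K * t))\<^sup>2" by (simp add: power2_eq_square)
    finally have D_le: "\<bar>?D t\<bar> \<le> e * exp (K * t)"
      using \<open>e \<ge> 0\<close> by (simp add: abs_le_square_iff[symmetric])
    have e_eq: "e = A4 * L" by (simp add: e_def A4_def)
    have DL: "\<bar>?D t\<bar> + L \<le> (A4 + 1) * L * exp (K * t)"
    proof -
      have "L * 1 \<le> L * exp (K * t)" using nn t L by (intro mult_left_mono) auto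
      then show ?thesis using D_le by (simp add: e_eq algebra_simps)
    qed
    have "\<bar>u t - p t\<bar> \<le> (b * (\<bar>?D t\<bar> + L) + k * (\<bar>?D t\<bar> + L)) / (2 * \<gamma>)"
      using du[OF t] nn L pos by (elim order_trans) (auto intro!: divide_right_mono add_mono mult_left_mono)
    also have "\<dots> = A3 * (\<bar>?D t\<bar> + L)" by (simp add: A3_def distrib_right)
    finally have du3: "\<bar>u t - p t\<bar> \<le> A3 * (\<bar>?D t\<bar> + L)" .
    have r: "0 \<le> u t" "u t \<le> 1" "0 \<le> p t" "p t \<le> 1" "0 \<le> P t" "P t \<le> \<sigma>" using solvesD[OF S t] solvesD[OF P t] by auto
    have "productivity M (S t) (u t) - productivity M (P t) (p t)
        = ?D t + ((\<beta> - 1) * u t) * ?D t + ((\<beta> - 1) * P t + \<alpha> - \<gamma> * (u t + p t)) * (u t - p t)"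
      by (simp add: productivity_alt power2_eq_square algebra_simps)
    also have "\<bar>\<dots>\<bar> \<le> \<bar>?D t\<bar> + b * \<bar>?D t\<bar> + A2 * \<bar>u t - p t\<bar>"
    proof -
      have 1: "\<bar>((\<beta> - 1) * u t) * ?D t\<bar> \<le> b * \<bar>?D t\<bar>"
        unfolding abs_mult b_def using r by (intro mult_right_mono) (auto simp: mult_left_le)
      have "\<bar>(\<beta> - 1) * P t\<bar> \<le> b * \<sigma>" unfolding abs_mult b_def using r by (intro mult_left_mono) auto
      moreover have "0 \<le> \<gamma> * (u t + p t)" "\<gamma> * (u t + p t) \<le> \<gamma> * 2" using r pos by (auto intro!: mult_left_mono)
      ultimately have "\<bar>(\<beta> - 1) * P t + \<alpha> - \<gamma> * (u t + p t)\<bar> \<le> A2" unfolding A2_def using pos by linarith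
      then have 2: "\<bar>((\<beta> - 1) * P t + \<alpha> - \<gamma> * (u t + p t)) * (u t - p t)\<bar> \<le> A2 * \<bar>u t - p t\<bar>"
        unfolding abs_mult by (rule mult_right_mono) simp
      show ?thesis using 1 2 by linarith
    qed
    also have "\<dots> \<le> (1 + b) * (\<bar>?D t\<bar> + L) + A2 * (A3 * (\<bar>?D t\<bar> + L))"
    proof (rule add_mono)
      show "A2 * \<bar>u t - p t\<bar> \<le> A2 * (A3 * (\<bar>?D t\<bar> + L))" using du3 nn by (intro mult_left_mono)
      have "(1 + b) * \<bar>?D t\<bar> \<le> (1 + b) * (\<bar>?D t\<bar> + L)" using nn L by (intro mult_left_mono) auto
      then show "\<bar>?D t\<bar> + b * \<bar>?D t\<bar> \<le> (1 + b) * (\<bar>?D t\<bar> + L)" by (simp add: algebra_simps)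
    qed
    also have "\<dots> = (1 + b + A2 * A3) * (\<bar>?D t\<bar> + L)" by (simp add: algebra_simps)
    also have "\<dots> \<le> (1 + b + A2 * A3) * ((A4 + 1) * L * exp (K * t))"
      using DL nn by (intro mult_left_mono) auto
    finally show ?thesis by (simp add: B_def mult.assoc)
  qed
  ultimately show ?thesis by (rule that)
qed

text \<open>As \<open>d\<close> tends to \<open>0\<close>, the long-run shortfall costs an amount of
  order \<open>1 / d\<close>, while the transient contributes a bounded amount.\<close>

lemma low_steady_state_patient_loss:
  assumes P: "flow f" and lim: "(f \<longlongrightarrow> y) at_top" and y: "y < c"
  obtains dbar where "dbar > 0" "\<And>d. 0 < d \<Longrightarrow> d < dbar \<Longrightarrow> discounted d f < c / d"
proof -
  obtain C where C: "\<And>t. t \<ge> 0 \<Longrightarrow> \<bar>f t\<bar> \<le> C" using P by (auto simp: flow_def)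
  define \<epsilon> where "\<epsilon> = (c - y) / 2"
  have \<epsilon>: "\<epsilon> > 0" "y < c - \<epsilon>" using y by (simp_all add: \<epsilon>_def field_simps)
  from order_tendstoD(2)[OF lim \<epsilon>(2)] obtain T where T: "\<And>t. t \<ge> T \<Longrightarrow> f t < c - \<epsilon>"
    by (auto simp: eventually_at_top_linorder)
  \<comment> \<open>Chosen so that \<open>A * exp (- t)\<close> is at least
    \<open>C + \<bar>c\<bar> + \<epsilon>\<close> before \<open>T\<close> and thus covers the
    transient; the decay rate \<open>1\<close> is arbitrary.\<close>
  define A where "A = (C + \<bar>c\<bar> + \<epsilon>) * exp T"
  have "C \<ge> 0" using C[of 0] by simp
  then have A: "A > 0" using \<epsilon> by (simp add: A_def add_pos_nonneg add_nonneg_pos)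
  have le: "f t \<le> (c - \<epsilon>) + A * exp (- 1 * t)" if "t \<ge> 0" for t
  proof (cases "t \<ge> T")
    case True
    then have "f t < c - \<epsilon>" by (rule T)
    moreover have "0 \<le> A * exp (- 1 * t)" using A by simp
    ultimately show ?thesis by linarith
  next
    case False
    have "(C + \<bar>c\<bar> + \<epsilon>) * 1 \<le> (C + \<bar>c\<bar> + \<epsilon>) * exp (T - t)"
      using False \<open>C \<ge> 0\<close> \<epsilon> by (intro mult_left_mono) auto
    also have "\<dots> = A * exp (- 1 * t)" by (simp add: A_def exp_diff exp_minus field_simps)
    finally have "C + \<bar>c\<bar> + \<epsilon> \<le> A * exp (- 1 * t)" by simp
    moreover have "f t \<le> C" "- c \<le> \<bar>c\<bar>" using C[OF that] by auto
    ultimately show ?thesis by linarith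
  qed
  show ?thesis
  \<comment> \<open>Below this threshold the shortfall \<open>\<epsilon> / d\<close> exceeds
    \<open>A\<close>, which bounds the transient at every rate.\<close>
  proof (rule that[of "\<epsilon> / A"])
    show "\<epsilon> / A > 0" using \<epsilon> A by simp
    fix d assume d: "0 < d" "d < \<epsilon> / A"
    have fe: "flow (\<lambda>t. A * exp (- 1 * t))" by (rule flow_mult[OF flow_const flow_exp_decay]) simp
    have "discounted d f \<le> discounted d (\<lambda>t. (c - \<epsilon>) + A * exp (- 1 * t))"
      by (rule discounted_mono[OF d(1) P flow_add[OF flow_const fe] le])
    also have "\<dots> = (c - \<epsilon>) / d + A * (1 / (d + 1))"
      unfolding discounted_add[OF d(1) flow_const fe] discounted_cmult
      using discounted_exp_decay[OF d(1), of 1] discounted_const[OF d(1)] by simp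
    also have "A * (1 / (d + 1)) \<le> A" using A d by (simp add: field_simps)
    also have "(c - \<epsilon>) / d + A < c / d" using d A by (simp add: field_simps)
    finally show "discounted d f < c / d" by simp
  qed
qed

text \<open>\<open>dbar\<close> comes from the myopic path alone and precedes the choice of
  \<open>\<delta>\<close>. For fixed \<open>d\<close> the loss along that path is strict, and the
  error bound \<open>E\<close>, which mentions no policy, eventually falls below it.\<close>

lemma myopic_limit_trap:
  assumes m: "myopic_policy M m" and ss: "steady_state M m x" and low: "productivity M x (m x) < \<sigma>"
  obtains dbar where "dbar > 0"
    "\<And>d. 0 < d \<Longrightarrow> d < dbar \<Longrightarrow> \<forall>\<^sub>F \<delta> in at_top. \<forall>\<phi> S.
       optimal_policy M (payoff \<delta> 0) \<phi> \<and> closed_loop M \<phi> \<sigma> S \<longrightarrow> payoff d 0 (\<lambda>t. \<phi> (S t)) S < \<sigma> / d"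
proof -
  obtain P where P: "closed_loop M m \<sigma> P" "(P \<longlongrightarrow> x) at_top" and x: "x \<in> {0..\<sigma>}"
    using ss by (auto simp: steady_state_def)
  have mr: "m y \<in> {0..1}" if "y \<in> {0..\<sigma>}" for y using m that by (simp add: myopic_policy_def)
  define p where "p = (\<lambda>t. m (P t))"
  have sP: "solves p P" unfolding p_def using closed_loop_solves[OF P(1) mr] by simp
  have p: "p t = best_usage (\<alpha> + (\<beta> - 1) * P t)" if "t \<ge> 0" for t
    using myopic_policy_eq[OF m, of "P t"] solvesD[OF sP that] by (simp add: p_def)
  define f where "f = (\<lambda>t. productivity M (P t) (p t))"
  have ff: "flow f" using flow_payoff[OF solves_flow_usage[OF sP] solves_flow_path[OF sP], of 0] by (simp add: f_def)
  define h where "h = (\<lambda>y. productivity M y (best_usage (\<alpha> + (\<beta> - 1) * y)))"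
  have "continuous_on UNIV h" unfolding h_def productivity_alt by (intro continuous_intros)
  then have "isCont h x" by (simp add: continuous_on_eq_continuous_at)
  then have "((\<lambda>t. h (P t)) \<longlongrightarrow> h x) at_top" using P(2) by (rule isCont_tendsto_compose)
  moreover have "\<forall>\<^sub>F t in at_top. h (P t) = f t"
    using eventually_ge_at_top[of 0] by eventually_elim (simp add: h_def f_def p)
  ultimately have "(f \<longlongrightarrow> h x) at_top" by (rule Lim_transform_eventually)
  moreover have "h x < \<sigma>" using low myopic_policy_eq[OF m x] by (simp add: h_def)
  ultimately obtain dbar where dbar: "dbar > 0" "\<And>d. 0 < d \<Longrightarrow> d < dbar \<Longrightarrow> discounted d f < \<sigma> / d"
    using low_steady_state_patient_loss[OF ff] by blast
  obtain B K where "B \<ge> 0" and BK: "\<And>u S p P l L t. solves u S \<Longrightarrow> solves p P \<Longrightarrow> S 0 = P 0 \<Longrightarrow> L \<ge> 0 \<Longrightarrow>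
      (\<And>t. t \<ge> 0 \<Longrightarrow> u t = best_usage (\<alpha> + (\<beta> - 1) * S t - \<kappa> * \<sigma> * l t)) \<Longrightarrow>
      (\<And>t. t \<ge> 0 \<Longrightarrow> p t = best_usage (\<alpha> + (\<beta> - 1) * P t)) \<Longrightarrow>
      (\<And>t. t \<ge> 0 \<Longrightarrow> \<bar>l t\<bar> \<le> L) \<Longrightarrow> t \<ge> 0 \<Longrightarrow>
      \<bar>productivity M (S t) (u t) - productivity M (P t) (p t)\<bar> \<le> B * L * exp (K * t)"
    by (rule small_costate_tracks_myopic) blast
  define C where "C = 2 * (\<sigma> + (\<alpha> + \<bar>\<beta> - 1\<bar> * \<sigma>) + \<gamma>)"
  have "C \<ge> 0" using pos by (simp add: C_def)
  \<comment> \<open>The tracking bound grows like \<open>exp (K * t)\<close>, which discounting at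
    \<open>d\<close> need not outweigh. The cap \<open>C\<close>, twice the bound on productivity,
    supplies an integrable majorant for dominated convergence.\<close>
  define E where "E = (\<lambda>\<delta> t. min C (B * (max 1 \<beta> / (\<delta> + \<kappa>)) * exp (K * t)))"
  show ?thesis
  proof (rule that[OF dbar(1)])
    fix d assume d: "0 < d" "d < dbar"
    have E_bd: "\<bar>E \<delta> t\<bar> \<le> C" if "\<delta> > 0" for \<delta> t
    proof -
      have "0 \<le> B * (max 1 \<beta> / (\<delta> + \<kappa>)) * exp (K * t)" using \<open>B \<ge> 0\<close> pos that by simp
      then show ?thesis using \<open>C \<ge> 0\<close> by (simp add: E_def)
    qed
    have fE: "flow (E \<delta>)" if "\<delta> > 0" for \<delta>
    proof (rule flow_continuous)
      show "continuous_on {0..} (E \<delta>)" unfolding E_def by (intro continuous_intros)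
    qed (use E_bd[OF that] in auto)
    have "((\<lambda>\<delta>. \<integral>t. indicator {0..} t *\<^sub>R (exp (- d * t) * E \<delta> t) \<partial>lborel) \<longlongrightarrow> (\<integral>t. 0 \<partial>(lborel :: real measure))) at_top"
    proof (rule integral_dominated_convergence_at_top[where w="\<lambda>t. indicator {0..} t *\<^sub>R (exp (- d * t) * C)"])
      have cE: "continuous_on UNIV (E \<delta>)" for \<delta> unfolding E_def by (intro continuous_intros)
      have "E \<delta> \<in> borel_measurable borel" for \<delta> by (rule borel_measurable_continuous_onI[OF cE])
      then show "(\<lambda>t. indicator {0..} t *\<^sub>R (exp (- d * t) * E \<delta> t)) \<in> borel_measurable lborel" for \<delta>
        by measurable
      show "integrable lborel (\<lambda>t. indicator {0..} t *\<^sub>R (exp (- d * t) * C))"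
        using discounted_integrable[OF flow_const d(1), of C] by (simp add: set_integrable_def)
      have "((\<lambda>\<delta>. E \<delta> t) \<longlongrightarrow> min C 0) at_top" for t
      proof -
        have "((\<lambda>\<delta>. max 1 \<beta> / (\<delta> + \<kappa>)) \<longlongrightarrow> 0) at_top" by real_asymp
        then have "((\<lambda>\<delta>. B * (max 1 \<beta> / (\<delta> + \<kappa>)) * exp (K * t)) \<longlongrightarrow> B * 0 * exp (K * t)) at_top"
          by (intro tendsto_intros)
        then show ?thesis unfolding E_def by (intro tendsto_min tendsto_const) simp
      qed
      then have "((\<lambda>\<delta>. indicator {0..} t *\<^sub>R (exp (- d * t) * E \<delta> t)) \<longlongrightarrow> indicator {0..} t *\<^sub>R (exp (- d * t) * min C 0)) at_top" for t
        by (intro tendsto_intros)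
      then show "AE t in lborel. ((\<lambda>\<delta>. indicator {0..} t *\<^sub>R (exp (- d * t) * E \<delta> t)) \<longlongrightarrow> 0) at_top"
        using \<open>C \<ge> 0\<close> by simp
      show "\<forall>\<^sub>F \<delta> in at_top. AE t in lborel. norm (indicator {0..} t *\<^sub>R (exp (- d * t) * E \<delta> t)) \<le> indicator {0..} t *\<^sub>R (exp (- d * t) * C)"
        using eventually_gt_at_top[of 0]
      proof eventually_elim
        case (elim \<delta>)
        show ?case using E_bd[OF elim] by (intro AE_I2) (simp add: indicator_def abs_mult)
      qed
    qed simp
    then have "((\<lambda>\<delta>. discounted d (E \<delta>)) \<longlongrightarrow> 0) at_top"
      by (simp add: discounted_def set_lebesgue_integral_def)
    then have "\<forall>\<^sub>F \<delta> in at_top. discounted d (E \<delta>) < \<sigma> / d - discounted d f"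
      using dbar(2)[OF d] by (intro order_tendstoD(2)) auto
    then show "\<forall>\<^sub>F \<delta> in at_top. \<forall>\<phi> S.
        optimal_policy M (payoff \<delta> 0) \<phi> \<and> closed_loop M \<phi> \<sigma> S \<longrightarrow> payoff d 0 (\<lambda>t. \<phi> (S t)) S < \<sigma> / d"
      using eventually_gt_at_top[of 0]
    proof eventually_elim
      case (elim \<delta>)
      show ?case
      proof (intro allI impI)
        fix \<phi> S assume a: "optimal_policy M (payoff \<delta> 0) \<phi> \<and> closed_loop M \<phi> \<sigma> S"
        note o = closed_loop_optimal[OF conjunct1[OF a] conjunct2[OF a]]
        have init: "S 0 = \<sigma>" "P 0 = \<sigma>" using a P(1) by (auto simp: closed_loop_def)
        have o': "optimal \<delta> 0 (S 0) (\<lambda>t. \<phi> (S t)) S" using o(1) by (simp add: init)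
        obtain l where l: "\<And>t. t \<ge> 0 \<Longrightarrow> \<phi> (S t) = best_usage (\<alpha> + (\<beta> - 1) * S t - \<kappa> * \<sigma> * l t)"
          "\<And>t. t \<ge> 0 \<Longrightarrow> min 1 \<beta> / (\<delta> + \<kappa>) \<le> l t"
          "\<And>t. t \<ge> 0 \<Longrightarrow> l t \<le> (max 1 \<beta> + 0) / (\<delta> + \<kappa>)"
          by (rule maximum_principle[OF o(2) o' elim(2) order_refl]) blast
        have lb: "\<bar>l t\<bar> \<le> max 1 \<beta> / (\<delta> + \<kappa>)" if "t \<ge> 0" for t
        proof -
          have "0 \<le> min 1 \<beta> / (\<delta> + \<kappa>)" using pos elim by simp
          then show ?thesis using l(2,3)[OF that] by simp
        qed
        have L: "0 \<le> max 1 \<beta> / (\<delta> + \<kappa>)" using pos elim by simp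
        have le: "productivity M (S t) (\<phi> (S t)) \<le> f t + E \<delta> t" if "t \<ge> 0" for t
        proof -
          have "\<bar>productivity M (S t) (\<phi> (S t)) - f t\<bar> \<le> B * (max 1 \<beta> / (\<delta> + \<kappa>)) * exp (K * t)"
            unfolding f_def by (rule BK[OF o(2) sP _ L l(1) p lb that]) (simp_all add: init)
          moreover have "\<bar>productivity M (S t) (\<phi> (S t))\<bar> \<le> C / 2" "\<bar>f t\<bar> \<le> C / 2"
            using productivity_bounded[of "S t" "\<phi> (S t)"] productivity_bounded[of "P t" "p t"]
              solvesD[OF o(2) that] solvesD[OF sP that] by (auto simp: C_def f_def)
          ultimately show ?thesis unfolding E_def by linarith
        qed
        have fS: "flow (\<lambda>t. productivity M (S t) (\<phi> (S t)))"
          using flow_payoff[OF solves_flow_usage[OF o(2)] solves_flow_path[OF o(2)], of 0] by simp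
        have "payoff d 0 (\<lambda>t. \<phi> (S t)) S \<le> discounted d (\<lambda>t. f t + E \<delta> t)"
          unfolding payoff_def using discounted_mono[OF d(1) fS flow_add[OF ff fE[OF elim(2)]] le] by simp
        also have "\<dots> = discounted d f + discounted d (E \<delta>)"
          by (rule discounted_add[OF d(1) ff fE[OF elim(2)]])
        finally show "payoff d 0 (\<lambda>t. \<phi> (S t)) S < \<sigma> / d" using elim(1) by simp
      qed
    qed
  qed
qed

end

section \<open>Uniqueness of the firm's path out of full skill\<close>

context skill_model
begin

text \<open>The maximum of \<open>a * v - \<gamma> * v\<^sup>2\<close> over \<open>{0..1}\<close>:
  the convex conjugate of the usage cost, with derivative \<open>best_usage\<close>.\<close>

definition usage_surplus :: "real \<Rightarrow> real" where
  "usage_surplus a = a * best_usage a - \<gamma> * (best_usage a)\<^sup>2"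

lemma usage_surplus_ge:
  assumes "v \<in> {0..1}" shows "a * v - \<gamma> * v\<^sup>2 \<le> usage_surplus a"
proof -
  have "usage_surplus a - (a * v - \<gamma> * v\<^sup>2)
      = (best_usage a - v) * (a - 2 * \<gamma> * best_usage a) + \<gamma> * (best_usage a - v)\<^sup>2"
    by (simp add: usage_surplus_def power2_eq_square algebra_simps)
  moreover have "0 \<le> \<gamma> * (best_usage a - v)\<^sup>2" using pos by simp
  ultimately show ?thesis using best_usage_first_order[OF assms, of a] by linarith
qed

lemma usage_surplus_subgradient: "usage_surplus a + (b - a) * best_usage a \<le> usage_surplus b"
  using usage_surplus_ge[OF best_usage_range, of b a] by (simp add: usage_surplus_def algebra_simps)

text \<open>Envelope theorem: the subgradient inequalities at \<open>a\<close> and \<open>b\<close>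
  squeeze the error, and \<open>best_usage\<close> is Lipschitz. Differentiability also holds where
  \<open>best_usage\<close> has kinks, so the maximized Hamiltonian is smooth enough there.\<close>

lemma usage_surplus_deriv: "(usage_surplus has_real_derivative best_usage a) (at a)"
  unfolding has_field_derivative_iff
proof (rule LIM_zero_cancel, rule Lim_null_comparison)
  show "((\<lambda>b. \<bar>b - a\<bar> / (2 * \<gamma>)) \<longlongrightarrow> 0) (at a)"
    using pos by (auto intro!: tendsto_eq_intros)
  show "\<forall>\<^sub>F b in at a. norm ((usage_surplus b - usage_surplus a) / (b - a) - best_usage a) \<le> \<bar>b - a\<bar> / (2 * \<gamma>)"
    unfolding eventually_at_filter
  proof (intro always_eventually allI impI)
    fix b :: real assume "b \<noteq> a"
    have "\<bar>usage_surplus b - usage_surplus a - (b - a) * best_usage a\<bar> \<le> \<bar>(b - a) * (best_usage b - best_usage a)\<bar>"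
      using usage_surplus_subgradient[of a b] usage_surplus_subgradient[of b a] by (simp add: algebra_simps)
    also have "\<dots> \<le> \<bar>b - a\<bar> * (\<bar>b - a\<bar> / (2 * \<gamma>))"
      unfolding abs_mult by (intro mult_left_mono best_usage_lipschitz) simp
    finally have "\<bar>usage_surplus b - usage_surplus a - (b - a) * best_usage a\<bar> / \<bar>b - a\<bar> \<le> \<bar>b - a\<bar> / (2 * \<gamma>)"
      using \<open>b \<noteq> a\<close> by (simp add: pos_divide_le_eq mult.commute)
    moreover have "(usage_surplus b - usage_surplus a) / (b - a) - best_usage a
        = (usage_surplus b - usage_surplus a - (b - a) * best_usage a) / (b - a)"
      using \<open>b \<noteq> a\<close> by (simp add: diff_divide_distrib)
    ultimately show "norm ((usage_surplus b - usage_surplus a) / (b - a) - best_usage a) \<le> \<bar>b - a\<bar> / (2 * \<gamma>)"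
      by (simp add: abs_divide)
  qed
qed

text \<open>The left-hand side is the maximized current-value Hamiltonian at time \<open>0\<close>; its time derivative
  along an extremal is \<open>d\<close> times costate times drift.\<close>

lemma hamiltonian_value:
  assumes S: "solves u S" and d: "d > 0"
    and u: "\<And>t. t \<ge> 0 \<Longrightarrow> u t = best_usage (\<alpha> + (\<beta> - 1) * S t - \<kappa> * \<sigma> * l t)"
    and l: "\<And>t. t \<ge> 0 \<Longrightarrow> (l has_real_derivative (d + \<kappa>) * l t - (1 + (\<beta> - 1) * u t)) (at t within {0..})"
    and lb: "\<And>t. t \<ge> 0 \<Longrightarrow> \<bar>l t\<bar> \<le> L"
  shows "S 0 + l 0 * (\<kappa> * (\<sigma> - S 0)) + usage_surplus (\<alpha> + (\<beta> - 1) * S 0 - \<kappa> * \<sigma> * l 0) = d * payoff d 0 u S"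
proof -
  define a where "a = (\<lambda>t. \<alpha> + (\<beta> - 1) * S t - \<kappa> * \<sigma> * l t)"
  define H where "H = (\<lambda>t. S t + l t * (\<kappa> * (\<sigma> - S t)) + usage_surplus (a t))"
  define b where "b = (\<lambda>t. skill_drift M (S t) (u t))"
  let ?q = "\<lambda>t. 1 + (\<beta> - 1) * u t"
  have ua: "u t = best_usage (a t)" if "t \<ge> 0" for t using u[OF that] by (simp add: a_def)
  have b_eq: "b t = \<kappa> * (\<sigma> - S t) - \<kappa> * \<sigma> * u t" for t by (simp add: b_def skill_drift_def algebra_simps)
  have S': "(S has_real_derivative b t) (at t within {0..})" if "t \<ge> 0" for t
    unfolding b_def by (rule solvesD(5)[OF S that])
  have H': "(H has_real_derivative d * l t * b t) (at t within {0..})" if t: "t \<ge> 0" for t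
  proof -
    let ?l' = "(d + \<kappa>) * l t - ?q t"
    have "(a has_real_derivative (\<beta> - 1) * b t - \<kappa> * \<sigma> * ?l') (at t within {0..})"
      unfolding a_def
      by (rule DERIV_cong[OF DERIV_diff[OF DERIV_add[OF DERIV_const DERIV_cmult[OF S'[OF t]]] DERIV_cmult[OF l[OF t]]]]) simp
    from DERIV_chain2[OF usage_surplus_deriv this]
    have 1: "((\<lambda>t. usage_surplus (a t)) has_real_derivative u t * ((\<beta> - 1) * b t - \<kappa> * \<sigma> * ?l')) (at t within {0..})"
      by (simp add: ua[OF t])
    have 2: "((\<lambda>t. l t * (\<kappa> * (\<sigma> - S t))) has_real_derivative ?l' * (\<kappa> * (\<sigma> - S t)) + (\<kappa> * (0 - b t)) * l t) (at t within {0..})"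
      by (rule DERIV_mult[OF l[OF t] DERIV_cmult[OF DERIV_diff[OF DERIV_const S'[OF t]]]])
    show ?thesis
      unfolding H_def
      by (rule DERIV_cong[OF DERIV_add[OF DERIV_add[OF S'[OF t] 2] 1]]) (simp add: b_eq algebra_simps)
  qed
  have H_eq: "H t = productivity M (S t) (u t) + l t * b t" if "t \<ge> 0" for t
    using that by (simp add: H_def usage_surplus_def ua productivity_alt b_eq a_def algebra_simps)
  let ?C = "(\<sigma> + (\<alpha> + \<bar>\<beta> - 1\<bar> * \<sigma>) + \<gamma>) + L * (2 * \<kappa> * \<sigma>)"
  have Hb: "\<bar>- H t\<bar> \<le> ?C" if t: "t \<ge> 0" for t
  proof -
    have r: "S t \<in> {0..\<sigma>}" "u t \<in> {0..1}" using solvesD[OF S t] by auto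
    have "0 \<le> \<kappa> * (\<sigma> - S t)" "0 \<le> \<kappa> * S t" "0 \<le> \<kappa> * \<sigma> * u t" "\<kappa> * \<sigma> * u t \<le> \<kappa> * \<sigma> * 1"
      using r pos by (auto intro!: mult_left_mono simp del: mult_1_right)
    then have "\<bar>b t\<bar> \<le> 2 * \<kappa> * \<sigma>" unfolding b_eq abs_le_iff by (simp add: algebra_simps)
    then have "\<bar>l t * b t\<bar> \<le> L * (2 * \<kappa> * \<sigma>)"
      unfolding abs_mult using lb[OF t] lb[of 0] pos by (intro mult_mono) auto
    then show ?thesis using productivity_bounded[OF r] H_eq[OF t] by linarith
  qed
  have fp: "flow (\<lambda>t. productivity M (S t) (u t))"
    using flow_payoff[OF solves_flow_usage[OF S] solves_flow_path[OF S], of 0] by simp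
  \<comment> \<open>From \<open>H = productivity + l * b\<close> and \<open>H' = d * l * b\<close>,
    the derivative of the discounted \<open>- H\<close> retains only \<open>d\<close> times
    productivity.\<close>
  have "discounted d (\<lambda>t. d * productivity M (S t) (u t)) = - (exp (- d * 0) * (- H 0))"
  proof (rule discounted_derivative[where F="\<lambda>t. exp (- d * t) * (- H t)"])
    show "((\<lambda>t. exp (- d * t) * (- H t)) has_real_derivative exp (- d * t) * (d * productivity M (S t) (u t))) (at t within {0..})"
      if t: "t \<ge> 0" for t
    proof -
      have E: "((\<lambda>t. exp (- d * t)) has_real_derivative - d * exp (- d * t)) (at t within {0..})"
        by (auto intro!: derivative_eq_intros)
      show ?thesis
        by (rule DERIV_cong[OF DERIV_mult[OF E DERIV_minus[OF H'[OF t]]]]) (simp add: H_eq[OF t] algebra_simps)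
    qed
    show "((\<lambda>t. exp (- d * t) * (- H t)) \<longlongrightarrow> 0) at_top" by (rule discounted_tendsto_0[OF Hb d])
  qed (use d fp in auto)
  then show ?thesis by (simp add: discounted_cmult payoff_def H_def a_def)
qed

text \<open>Eliminating the control through \<open>best_usage\<close> leaves a Lipschitz system for
  skill and costate, so initial skill and costate determine everything.\<close>

lemma extremal_unique:
  assumes S: "solves u1 S1" "solves u2 S2" and d: "d > 0"
    and u1: "\<And>t. t \<ge> 0 \<Longrightarrow> u1 t = best_usage (\<alpha> + (\<beta> - 1) * S1 t - \<kappa> * \<sigma> * l1 t)"
    and l1: "\<And>t. t \<ge> 0 \<Longrightarrow> (l1 has_real_derivative (d + \<kappa>) * l1 t - (1 + (\<beta> - 1) * u1 t)) (at t within {0..})"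
    and u2: "\<And>t. t \<ge> 0 \<Longrightarrow> u2 t = best_usage (\<alpha> + (\<beta> - 1) * S2 t - \<kappa> * \<sigma> * l2 t)"
    and l2: "\<And>t. t \<ge> 0 \<Longrightarrow> (l2 has_real_derivative (d + \<kappa>) * l2 t - (1 + (\<beta> - 1) * u2 t)) (at t within {0..})"
    and init: "S1 0 = S2 0" "l1 0 = l2 0" and t: "t \<ge> 0"
  shows "S1 t = S2 t" "u1 t = u2 t"
proof -
  define k where "k = \<kappa> * \<sigma>"
  define b where "b = \<bar>\<beta> - 1\<bar>"
  define A where "A = (b + k) / (2 * \<gamma>)"
  define R where "R = (k + b) * A + 2 * \<kappa> + d"
  have nn: "k > 0" "b \<ge> 0" "A \<ge> 0" "R \<ge> 0" using pos d by (auto simp: k_def b_def A_def R_def)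
  define D E U where "D = (\<lambda>t. S1 t - S2 t)" and "E = (\<lambda>t. l1 t - l2 t)" and "U = (\<lambda>t. u1 t - u2 t)"
  have U: "\<bar>U t\<bar> \<le> A * (\<bar>D t\<bar> + \<bar>E t\<bar>)" if "t \<ge> 0" for t
  proof -
    have "\<bar>U t\<bar> \<le> \<bar>(\<alpha> + (\<beta> - 1) * S1 t - \<kappa> * \<sigma> * l1 t) - (\<alpha> + (\<beta> - 1) * S2 t - \<kappa> * \<sigma> * l2 t)\<bar> / (2 * \<gamma>)"
      unfolding U_def u1[OF that] u2[OF that] by (rule best_usage_lipschitz)
    also have "(\<alpha> + (\<beta> - 1) * S1 t - \<kappa> * \<sigma> * l1 t) - (\<alpha> + (\<beta> - 1) * S2 t - \<kappa> * \<sigma> * l2 t) = (\<beta> - 1) * D t - k * E t"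
      by (simp add: k_def D_def E_def algebra_simps)
    also have "\<bar>(\<beta> - 1) * D t - k * E t\<bar> \<le> b * \<bar>D t\<bar> + k * \<bar>E t\<bar>"
      unfolding b_def using nn abs_triangle_ineq4[of "(\<beta> - 1) * D t" "k * E t"] by (simp add: abs_mult)
    also have "\<dots> \<le> (b + k) * (\<bar>D t\<bar> + \<bar>E t\<bar>)" using nn by (simp add: algebra_simps)
    finally show ?thesis using pos by (simp add: A_def divide_right_mono)
  qed
  define D' E' where "D' = (\<lambda>t. - k * U t - \<kappa> * D t)" and "E' = (\<lambda>t. (d + \<kappa>) * E t - (\<beta> - 1) * U t)"
  have derD: "(D has_real_derivative D' t) (at t within {0..})" if "t \<ge> 0" for t
    unfolding D_def
    by (rule DERIV_cong[OF DERIV_diff[OF solvesD(5)[OF S(1) that] solvesD(5)[OF S(2) that]]])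
       (simp add: skill_drift_def D'_def D_def U_def k_def algebra_simps)
  have derE: "(E has_real_derivative E' t) (at t within {0..})" if "t \<ge> 0" for t
    unfolding E_def
    by (rule DERIV_cong[OF DERIV_diff[OF l1[OF that] l2[OF that]]]) (simp add: E'_def E_def U_def algebra_simps)
  let ?X = "\<lambda>t. (D t)\<^sup>2 + (E t)\<^sup>2"
  have X': "(?X has_real_derivative 2 * (D t * D' t) + 2 * (E t * E' t)) (at t within {0..})" if "t \<ge> 0" for t
    by (rule DERIV_cong[OF DERIV_add[OF DERIV_power[OF derD[OF that], of 2] DERIV_power[OF derE[OF that], of 2]]])
       (simp add: algebra_simps)
  \<comment> \<open>The added \<open>1\<close> only secures the requirement \<open>K \<ge> 1\<close>
    of \<open>gronwall_square\<close>, and \<open>0\<^sup>2\<close> is its forcing.\<close>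
  have X_le: "2 * (D t * D' t) + 2 * (E t * E' t) \<le> (4 * R + 1) * ?X t + 0\<^sup>2" if "t \<ge> 0" for t
  proof -
    let ?n = "\<bar>D t\<bar> + \<bar>E t\<bar>"
    have "\<bar>D' t\<bar> \<le> k * \<bar>U t\<bar> + \<kappa> * \<bar>D t\<bar>"
      unfolding D'_def using nn pos abs_triangle_ineq4[of "- k * U t" "\<kappa> * D t"] by (simp add: abs_mult)
    also have "\<dots> \<le> k * (A * ?n) + \<kappa> * ?n"
      using U[OF that] nn pos by (intro add_mono mult_left_mono) auto
    also have "\<dots> \<le> R * ?n"
    proof -
      have "0 \<le> (b * A + \<kappa> + d) * ?n" using nn pos d by simp
      then show ?thesis by (simp add: R_def algebra_simps)
    qed
    finally have 1: "\<bar>D' t\<bar> \<le> R * ?n" .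
    have "\<bar>E' t\<bar> \<le> (d + \<kappa>) * \<bar>E t\<bar> + b * \<bar>U t\<bar>"
      unfolding E'_def b_def using d pos abs_triangle_ineq4[of "(d + \<kappa>) * E t" "(\<beta> - 1) * U t"] by (simp add: abs_mult)
    also have "\<dots> \<le> (d + \<kappa>) * ?n + b * (A * ?n)"
      using U[OF that] nn pos d by (intro add_mono mult_left_mono) auto
    also have "\<dots> \<le> R * ?n"
    proof -
      have "0 \<le> (k * A + \<kappa>) * ?n" using nn pos by simp
      then show ?thesis by (simp add: R_def algebra_simps)
    qed
    finally have 2: "\<bar>E' t\<bar> \<le> R * ?n" .
    have "D t * D' t \<le> \<bar>D t\<bar> * \<bar>D' t\<bar>" "E t * E' t \<le> \<bar>E t\<bar> * \<bar>E' t\<bar>"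
      by (metis abs_ge_self abs_mult)+
    moreover have "\<bar>D t\<bar> * \<bar>D' t\<bar> \<le> \<bar>D t\<bar> * (R * ?n)" "\<bar>E t\<bar> * \<bar>E' t\<bar> \<le> \<bar>E t\<bar> * (R * ?n)"
      using 1 2 by (intro mult_left_mono; simp)+
    ultimately have "2 * (D t * D' t) + 2 * (E t * E' t) \<le> 2 * (\<bar>D t\<bar> * (R * ?n)) + 2 * (\<bar>E t\<bar> * (R * ?n))"
      by linarith
    also have "\<dots> = 2 * R * (?X t + 2 * \<bar>D t\<bar> * \<bar>E t\<bar>)"
      by (simp add: algebra_simps power2_eq_square flip: abs_mult)
    also have "\<dots> \<le> 2 * R * (?X t + ?X t)"
      using sum_squares_bound[of "\<bar>D t\<bar>" "\<bar>E t\<bar>"] nn by (intro mult_left_mono) auto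
    also have "\<dots> \<le> (4 * R + 1) * ?X t" by (simp add: algebra_simps)
    finally show ?thesis by simp
  qed
  have "?X t \<le> 0\<^sup>2 * exp ((4 * R + 1) * t)"
    using gronwall_square[of ?X, OF X' X_le _ _ t] nn init by (simp add: D_def E_def)
  then have "D t = 0" "E t = 0"
    using sum_power2_eq_zero_iff[of "D t" "E t"] sum_power2_ge_zero[of "D t" "E t"] by auto
  then show "S1 t = S2 t" "u1 t = u2 t" using u1[OF t] u2[OF t] by (auto simp: D_def E_def)
qed

text \<open>Two optimal paths share the same value. At full skill the drift part of the Hamiltonian
  without usage vanishes, so \<open>usage_surplus\<close> agrees at both initial costates; it is
  strictly monotone where usage is positive, so the costates agree. With zero usage it is flat and
  would not determine them.\<close>

lemma firm_path_unique:
  assumes opt: "optimal_policy M (payoff d 0) \<phi>1" "optimal_policy M (payoff d 0) \<phi>2" and d: "d > 0"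
    and cl: "closed_loop M \<phi>1 \<sigma> S1" "closed_loop M \<phi>2 \<sigma> S2"
    and used: "0 < \<phi>1 \<sigma>" "0 < \<phi>2 \<sigma>" and t: "t \<ge> 0"
  shows "S1 t = S2 t" "\<phi>1 (S1 t) = \<phi>2 (S2 t)"
proof -
  note o1 = closed_loop_optimal[OF opt(1) cl(1)] and o2 = closed_loop_optimal[OF opt(2) cl(2)]
  have init: "S1 0 = \<sigma>" "S2 0 = \<sigma>" using cl by (auto simp: closed_loop_def)
  have o': "optimal d 0 (S1 0) (\<lambda>t. \<phi>1 (S1 t)) S1" "optimal d 0 (S2 0) (\<lambda>t. \<phi>2 (S2 t)) S2"
    using o1 o2 by (simp_all add: init)
  obtain l1 where l1: "\<And>t. t \<ge> 0 \<Longrightarrow> \<phi>1 (S1 t) = best_usage (\<alpha> + (\<beta> - 1) * S1 t - \<kappa> * \<sigma> * l1 t)"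
    "\<And>t. t \<ge> 0 \<Longrightarrow> (l1 has_real_derivative (d + \<kappa>) * l1 t - (1 + (\<beta> - 1) * \<phi>1 (S1 t) + 0)) (at t within {0..})"
    "\<And>t. t \<ge> 0 \<Longrightarrow> min 1 \<beta> / (d + \<kappa>) \<le> l1 t" "\<And>t. t \<ge> 0 \<Longrightarrow> l1 t \<le> (max 1 \<beta> + 0) / (d + \<kappa>)"
    by (rule maximum_principle[OF o1(2) o'(1) d order_refl]) blast
  obtain l2 where l2: "\<And>t. t \<ge> 0 \<Longrightarrow> \<phi>2 (S2 t) = best_usage (\<alpha> + (\<beta> - 1) * S2 t - \<kappa> * \<sigma> * l2 t)"
    "\<And>t. t \<ge> 0 \<Longrightarrow> (l2 has_real_derivative (d + \<kappa>) * l2 t - (1 + (\<beta> - 1) * \<phi>2 (S2 t) + 0)) (at t within {0..})"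
    "\<And>t. t \<ge> 0 \<Longrightarrow> min 1 \<beta> / (d + \<kappa>) \<le> l2 t" "\<And>t. t \<ge> 0 \<Longrightarrow> l2 t \<le> (max 1 \<beta> + 0) / (d + \<kappa>)"
    by (rule maximum_principle[OF o2(2) o'(2) d order_refl]) blast
  have lo: "0 \<le> min 1 \<beta> / (d + \<kappa>)" using pos d by simp
  have b: "\<bar>l1 t\<bar> \<le> (max 1 \<beta> + 0) / (d + \<kappa>)" "\<bar>l2 t\<bar> \<le> (max 1 \<beta> + 0) / (d + \<kappa>)" if "t \<ge> 0" for t
    using l1(3,4)[OF that] l2(3,4)[OF that] lo by (auto simp: abs_le_iff)
  note l1d = l1(2)[unfolded add_0_right] and l2d = l2(2)[unfolded add_0_right]
  define a1 where "a1 = \<alpha> + (\<beta> - 1) * \<sigma> - \<kappa> * \<sigma> * l1 0"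
  define a2 where "a2 = \<alpha> + (\<beta> - 1) * \<sigma> - \<kappa> * \<sigma> * l2 0"
  have "payoff d 0 (\<lambda>t. \<phi>1 (S1 t)) S1 = payoff d 0 (\<lambda>t. \<phi>2 (S2 t)) S2"
    using o1(1) o2(1) by (auto simp: optimal_def admissible_def intro: antisym)
  then have surplus: "usage_surplus a1 = usage_surplus a2"
    using hamiltonian_value[OF o1(2) d l1(1) l1d b(1)] hamiltonian_value[OF o2(2) d l2(1) l2d b(2)]
    by (simp add: init a1_def a2_def)
  have used': "0 < best_usage a1" "0 < best_usage a2"
    using used l1(1)[of 0] l2(1)[of 0] by (simp_all add: init a1_def a2_def)
  have "a1 = a2"
  proof (rule ccontr)
    assume "a1 \<noteq> a2"
    then consider "a1 < a2" | "a2 < a1" by linarith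
    then show False
    proof cases
      case 1
      then have "0 < (a2 - a1) * best_usage a1" using used' by simp
      then show False using usage_surplus_subgradient[of a1 a2] surplus by linarith
    next
      case 2
      then have "0 < (a1 - a2) * best_usage a2" using used' by simp
      then show False using usage_surplus_subgradient[of a2 a1] surplus by linarith
    qed
  qed
  then have l0: "l1 0 = l2 0" using pos by (simp add: a1_def a2_def)
  show "S1 t = S2 t" "\<phi>1 (S1 t) = \<phi>2 (S2 t)"
    using extremal_unique[OF o1(2) o2(2) d l1(1) l1d l2(1) l2d _ l0 t] by (simp_all add: init)
qed

text \<open>One reference path suffices for all policies, by uniqueness. Positive usage at full
  skill makes skill fall at once, so its discounted loss is positive and independent of
  \<open>w\<close>. If usage at full skill were zero, staying there would be a closed-loop path
  without any loss.\<close>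

lemma large_externality_trap:
  assumes d: "d > 0" and \<delta>: "\<delta> > 0"
  shows "\<forall>\<^sub>F w in at_top. \<forall>\<phi> S. optimal_policy M (payoff \<delta> 0) \<phi> \<and> 0 < \<phi> \<sigma> \<and> closed_loop M \<phi> \<sigma> S \<longrightarrow>
    payoff d w (\<lambda>t. \<phi> (S t)) S < (1 + w) * \<sigma> / d"
proof (cases "\<exists>\<phi> S. optimal_policy M (payoff \<delta> 0) \<phi> \<and> 0 < \<phi> \<sigma> \<and> closed_loop M \<phi> \<sigma> S")
  case True
  then obtain \<phi>0 S0 where o: "optimal_policy M (payoff \<delta> 0) \<phi>0" "0 < \<phi>0 \<sigma>" "closed_loop M \<phi>0 \<sigma> S0" by blast
  note sol = closed_loop_optimal(2)[OF o(1,3)]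
  have init: "S0 0 = \<sigma>" using o by (simp add: closed_loop_def)
  define p where "p = payoff d 0 (\<lambda>t. \<phi>0 (S0 t)) S0"
  define c where "c = discounted d (\<lambda>t. \<sigma> - S0 t)"
  have fS: "flow S0" by (rule solves_flow_path[OF sol])
  have c_eq: "discounted d S0 = \<sigma> / d - c"
    unfolding c_def discounted_diff[OF d flow_const fS] discounted_const[OF d] by simp
  have "((\<lambda>t. - S0 t) has_real_derivative - skill_drift M (S0 0) (\<phi>0 (S0 0))) (at 0 within {0..})"
    by (rule DERIV_minus[OF solvesD(5)[OF sol order_refl]])
  moreover have "0 < - skill_drift M (S0 0) (\<phi>0 (S0 0))"
    using o(2) pos by (simp add: init skill_drift_def algebra_simps)
  ultimately obtain e where e: "e > 0" "\<And>h. 0 < h \<Longrightarrow> h < e \<Longrightarrow> - S0 0 < - S0 (0 + h)"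
    using has_real_derivative_pos_inc_right[of "\<lambda>t. - S0 t" _ 0 "{0..}"] by force
  have "c > 0"
    unfolding c_def
  proof (rule discounted_pos[OF _ d _ order_refl e(1)])
    show "flow (\<lambda>t. \<sigma> - S0 t)" by (intro flow_diff flow_const fS)
    show "0 \<le> \<sigma> - S0 t" if "t \<ge> 0" for t using solvesD[OF sol that] by simp
    show "0 < \<sigma> - S0 t" if "0 < t" "t < e" for t using e(2)[OF that] by (simp add: init)
  qed
  \<comment> \<open>The threshold is the discounted productivity gain over no AI divided by the
    discounted skill loss \<open>c\<close>.\<close>
  show ?thesis
    using eventually_gt_at_top[of "(p - \<sigma> / d) / c"]
  proof eventually_elim
    case (elim w)
    have "p - \<sigma> / d < w * c" using elim \<open>c > 0\<close> by (simp add: pos_divide_less_eq)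
    then have lt: "payoff d w (\<lambda>t. \<phi>0 (S0 t)) S0 < (1 + w) * \<sigma> / d"
      using payoff_split[OF solves_flow_usage[OF sol] fS d, of w]
      by (simp add: c_eq p_def[symmetric] algebra_simps add_divide_distrib)
    show ?case
    proof (intro allI impI)
      fix \<phi> S assume a: "optimal_policy M (payoff \<delta> 0) \<phi> \<and> 0 < \<phi> \<sigma> \<and> closed_loop M \<phi> \<sigma> S"
      have "payoff d w (\<lambda>t. \<phi> (S t)) S = payoff d w (\<lambda>t. \<phi>0 (S0 t)) S0"
        unfolding payoff_def
        by (rule discounted_cong) (use firm_path_unique[of \<delta> \<phi> \<phi>0 S S0] a o \<delta> in auto)
      then show "payoff d w (\<lambda>t. \<phi> (S t)) S < (1 + w) * \<sigma> / d" using lt by simp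
    qed
  qed
next
  case False
  then show ?thesis by (intro always_eventually) blast
qed

section \<open>Alignment, divergence and the skill externality\<close>

text \<open>Discount rates and \<open>omega\<close> enter payoffs but not dynamics, so every record
  update in the theorem can be treated within the one model \<open>M\<close>.\<close>

lemma same_technology:
  assumes "alpha N = \<alpha>" "beta N = \<beta>" "gamma N = \<gamma>" "kappa N = \<kappa>" "Sbar N = \<sigma>"
  shows "firm_policy N \<phi> \<longleftrightarrow> optimal_policy M (payoff (deltaF N) 0) \<phi>"
    "worker_policy N \<phi> \<longleftrightarrow> optimal_policy M (payoff (deltaW N) (omega N)) \<phi>"
    "closed_loop N = closed_loop M"
    "worker_welfare N = payoff (deltaW N) (omega N)"
proof -
  have drift: "skill_drift N = skill_drift M" and prod: "productivity N = productivity M"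
    using assms by (simp_all add: fun_eq_iff skill_drift_def productivity_def)
  show cl: "closed_loop N = closed_loop M"
    by (simp add: fun_eq_iff closed_loop_def drift assms)
  have sp: "skill_path N = skill_path M"
    by (simp add: fun_eq_iff skill_path_def drift)
  have opt: "optimal_policy N J = optimal_policy M J" for J
    by (simp add: fun_eq_iff optimal_policy_def cl sp assms)
  have "firm_value N = payoff (deltaF N) 0"
    by (simp add: fun_eq_iff firm_value_def payoff_def prod)
  then show "firm_policy N \<phi> \<longleftrightarrow> optimal_policy M (payoff (deltaF N) 0) \<phi>"
    by (simp add: firm_policy_def opt)
  show ww: "worker_welfare N = payoff (deltaW N) (omega N)"
    by (simp add: fun_eq_iff worker_welfare_def payoff_def prod)
  show "worker_policy N \<phi> \<longleftrightarrow> optimal_policy M (payoff (deltaW N) (omega N)) \<phi>"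
    by (simp add: worker_policy_def opt ww)
qed

lemma augmentation_trap_iff:
  assumes "alpha N = \<alpha>" "beta N = \<beta>" "gamma N = \<gamma>" "kappa N = \<kappa>" "Sbar N = \<sigma>"
    and "0 < deltaW N" "0 < deltaF N" "0 \<le> omega N"
  shows "augmentation_trap N \<phi> S \<longleftrightarrow>
    payoff (deltaW N) (omega N) (\<lambda>t. \<phi> (S t)) S < (1 + omega N) * \<sigma> / deltaW N"
proof -
  have "valid_model N" using assms valid by (simp add: valid_model_def)
  then show ?thesis
    using noAI_welfare_eq[of N] same_technology(4)[of N] assms by (simp add: augmentation_trap_def)
qed

lemma own_policy_no_trap:
  assumes "optimal_policy M (worker_welfare M) \<phi>" "closed_loop M \<phi> \<sigma> S"
  shows "noAI_welfare M \<le> worker_welfare M (\<lambda>t. \<phi> (S t)) S"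
proof -
  have "usage_process (\<lambda>_. 0)" by (simp add: usage_process_iff)
  moreover have "\<sigma> \<in> {0..\<sigma>}" using pos by simp
  ultimately show ?thesis
    using assms skill_path_noAI[of M] unfolding optimal_policy_def noAI_welfare_def by blast
qed

text \<open>Skill never exceeds \<open>\<sigma>\<close>, so a private return to it cannot offset a
  shortfall in output; it suffices to establish the trap from productivity alone.\<close>

lemma payoff_externality_less:
  assumes "optimal_policy M (payoff \<delta> 0) \<phi>" "closed_loop M \<phi> \<sigma> S" and d: "d > 0" and "w \<ge> 0"
    and less: "payoff d 0 (\<lambda>t. \<phi> (S t)) S < \<sigma> / d"
  shows "payoff d w (\<lambda>t. \<phi> (S t)) S < (1 + w) * \<sigma> / d"
proof -
  note sol = closed_loop_optimal(2)[OF assms(1,2)]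
  have "discounted d S \<le> \<sigma> / d"
    using discounted_mono[OF d solves_flow_path[OF sol] flow_const[of \<sigma>]] solvesD(4)[OF sol] discounted_const[OF d]
    by simp
  then have "w * discounted d S \<le> w * (\<sigma> / d)" using \<open>w \<ge> 0\<close> by (rule mult_left_mono)
  then show ?thesis
    using less payoff_split[OF solves_flow_usage[OF sol] solves_flow_path[OF sol] d, of w]
    by (simp add: distrib_right add_divide_distrib)
qed

end

theorem proposition7:
  fixes M :: model
  assumes "valid_model M"
  shows
    "(deltaF M = deltaW M \<and> omega M = 0 \<longrightarrow>
        (\<forall>uW S. worker_policy M uW \<and> closed_loop M uW (Sbar M) S \<longrightarrow>
           worker_welfare M (\<lambda>t. uW (S t)) S \<ge> noAI_welfare M \<and>
           \<not> augmentation_trap M uW S))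
   \<and> ((deltaF M > deltaW M \<longrightarrow>
        (\<forall>uF uW. firm_policy M uF \<and> worker_policy M uW \<longrightarrow>
           (\<forall>x\<in>{0..Sbar M}. uF x \<ge> uW x \<and>
              (interior_at uF x \<and> interior_at uW x \<longrightarrow> uF x > uW x))))
      \<and> (\<forall>m Shat. myopic_policy M m \<and> steady_state M m Shat \<and>
           productivity M Shat (m Shat) < Sbar M \<longrightarrow>
           (\<exists>dbar>0. \<forall>dW. 0 < dW \<and> dW < dbar \<longrightarrow>
              (\<forall>\<^sub>F dF in at_top. \<forall>uF S.
                 firm_policy (M\<lparr>deltaW := dW, deltaF := dF\<rparr>) uF \<and>
                 closed_loop (M\<lparr>deltaW := dW, deltaF := dF\<rparr>) uF (Sbar M) S \<longrightarrow>
                 augmentation_trap (M\<lparr>deltaW := dW, deltaF := dF\<rparr>) uF S))))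
   \<and> ((\<forall>w>0. \<forall>\<phi>. firm_policy (M\<lparr>omega := w\<rparr>) \<phi> \<longleftrightarrow> firm_policy (M\<lparr>omega := 0\<rparr>) \<phi>)
      \<and> (\<forall>\<^sub>F w in at_top. \<forall>uF S.
           firm_policy (M\<lparr>omega := w\<rparr>) uF \<and> uF (Sbar M) > 0 \<and>
           closed_loop (M\<lparr>omega := w\<rparr>) uF (Sbar M) S \<longrightarrow>
           augmentation_trap (M\<lparr>omega := w\<rparr>) uF S))"
proof -
  interpret skill_model M by standard (rule assms)
  have dW: "0 < deltaW M" and dF: "0 < deltaF M" and om: "0 \<le> omega M"
    using assms by (auto simp: valid_model_def)
  note polM = same_technology[of M, OF refl refl refl refl refl]
  have 1: "worker_welfare M (\<lambda>t. uW (S t)) S \<ge> noAI_welfare M \<and> \<not> augmentation_trap M uW S"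
    if "worker_policy M uW" "closed_loop M uW (Sbar M) S" for uW S
    using own_policy_no_trap[of uW S] that by (simp add: worker_policy_def augmentation_trap_def)
  have 2: "uF x \<ge> uW x \<and> (interior_at uF x \<and> interior_at uW x \<longrightarrow> uF x > uW x)"
    if "deltaF M > deltaW M" "firm_policy M uF" "worker_policy M uW" "x \<in> {0..Sbar M}" for uF uW x
    using impatience_raises_usage[of "deltaF M" uF "deltaW M" "omega M" uW x] that dW om by (simp add: polM)
  have 3: "\<exists>dbar>0. \<forall>dW. 0 < dW \<and> dW < dbar \<longrightarrow>
      (\<forall>\<^sub>F dF in at_top. \<forall>uF S.
         firm_policy (M\<lparr>deltaW := dW, deltaF := dF\<rparr>) uF \<and>
         closed_loop (M\<lparr>deltaW := dW, deltaF := dF\<rparr>) uF (Sbar M) S \<longrightarrow>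
         augmentation_trap (M\<lparr>deltaW := dW, deltaF := dF\<rparr>) uF S)"
    if low: "myopic_policy M m" "steady_state M m Shat" "productivity M Shat (m Shat) < Sbar M" for m Shat
  proof -
    obtain dbar where dbar: "dbar > 0"
      "\<And>d. 0 < d \<Longrightarrow> d < dbar \<Longrightarrow> \<forall>\<^sub>F \<delta> in at_top. \<forall>\<phi> S.
         optimal_policy M (payoff \<delta> 0) \<phi> \<and> closed_loop M \<phi> \<sigma> S \<longrightarrow> payoff d 0 (\<lambda>t. \<phi> (S t)) S < \<sigma> / d"
      using myopic_limit_trap[OF low] by blast
    show ?thesis
    proof (intro exI[of _ dbar] conjI allI impI)
      fix d assume d: "0 < d \<and> d < dbar"
      have "\<forall>\<^sub>F \<delta> in at_top. \<forall>\<phi> S.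
         optimal_policy M (payoff \<delta> 0) \<phi> \<and> closed_loop M \<phi> \<sigma> S \<longrightarrow> payoff d 0 (\<lambda>t. \<phi> (S t)) S < \<sigma> / d"
        using dbar(2) d by blast
      then show "\<forall>\<^sub>F dF in at_top. \<forall>uF S.
         firm_policy (M\<lparr>deltaW := d, deltaF := dF\<rparr>) uF \<and>
         closed_loop (M\<lparr>deltaW := d, deltaF := dF\<rparr>) uF (Sbar M) S \<longrightarrow>
         augmentation_trap (M\<lparr>deltaW := d, deltaF := dF\<rparr>) uF S"
        using eventually_gt_at_top[of 0]
      proof eventually_elim
        case (elim \<delta>)
        show ?case
        proof (intro allI impI)
          let ?N = "M\<lparr>deltaW := d, deltaF := \<delta>\<rparr>"
          fix uF S assume "firm_policy ?N uF \<and> closed_loop ?N uF (Sbar M) S"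
          then have "optimal_policy M (payoff \<delta> 0) uF" "closed_loop M uF \<sigma> S"
            by (simp_all add: same_technology[of ?N])
          moreover from this have "payoff d 0 (\<lambda>t. uF (S t)) S < \<sigma> / d" using elim(1) by blast
          ultimately have "payoff d (omega M) (\<lambda>t. uF (S t)) S < (1 + omega M) * \<sigma> / d"
            using d om by (intro payoff_externality_less) auto
          then show "augmentation_trap ?N uF S"
            using d elim(2) om by (simp add: augmentation_trap_iff[of ?N])
        qed
      qed
    qed (rule dbar)
  qed
  have 4: "firm_policy (M\<lparr>omega := w\<rparr>) \<phi> \<longleftrightarrow> firm_policy (M\<lparr>omega := 0\<rparr>) \<phi>" for w \<phi>
    by (simp add: same_technology[of "M\<lparr>omega := w\<rparr>"] same_technology[of "M\<lparr>omega := 0\<rparr>"])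
  have 5: "\<forall>\<^sub>F w in at_top. \<forall>uF S.
      firm_policy (M\<lparr>omega := w\<rparr>) uF \<and> uF (Sbar M) > 0 \<and> closed_loop (M\<lparr>omega := w\<rparr>) uF (Sbar M) S \<longrightarrow>
      augmentation_trap (M\<lparr>omega := w\<rparr>) uF S"
    using large_externality_trap[OF dW dF] eventually_ge_at_top[of 0]
  proof eventually_elim
    case (elim w)
    then show ?case
      using dW dF by (simp add: same_technology[of "M\<lparr>omega := w\<rparr>"] augmentation_trap_iff[of "M\<lparr>omega := w\<rparr>"])
  qed
  show ?thesis using 1 2 3 4 5 by blast
qed

end
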